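(* Let $Z_n=(\mathrm{UD})^n$ denote the zig-zag Dyck path UDUD$\cdots$UD of order $n$. The maps $\operatorname{DTS}(Z_n,\cdot)$ and $\operatorname{DTR}(Z_n,\cdot)$ restrict to bijections between 231-avoiding permutations in $S_n$ and Dyck tilings whose lower path is $Z_n$ and which contain only one-box tiles.
   Context: A permutation $\sigma$ is 231-avoiding if there are no $i<j<k$ with $\sigma_k<\sigma_i<\sigma_j$. For $\lambda=Z_n$, the chord poset (chords = segments between matching up and down steps, ordered by nesting) is an antichain, so its set of linear extensions $\mathscr{L}(P_{Z_n})$ is all of $S_n$. Dyck tilings: for Dyck paths $\mu$ weakly above $\lambda$ (lattice paths with steps $(+1,\pm1)$ from $(-n,0)$ to $(n,0)$ staying at height $\ge0$), a Dyck tile is a ribbon tile (connected skew shape without a $2\times2$ square) whose leftmost and rightmost boxes are at equal height with no box below them; a Dyck tiling tiles the skew shape between $\lambda$ and $\mu$; it is cover-inclusive if whenever a tile has a box directly above a box of another tile, its horizontal extent is contained in that of the other. Labeled trees $(\lambda,\sigma)$ (chord poset of $\lambda$ with root adjoined, naturally labeled; $\sigma$ = standardization of the left endpoints $\ell_1,\dots,\ell_n$ of chords labeled $1,\dots,n$) correspond bijectively to sequences $p_1,\dots,p_n$ with $0\le p_i\le 2(i-1)$, $p_i=\#\{j<i:\ell_j<\ell_i\}+\#\{j<i:r_j<\ell_i\}$. The spread of a path at column $s$ shifts points with $x\le s$ by $(-1,0)$, points with $x\ge s$ by $(+1,0)$, and points at $x=s$ also by $(0,+1)$; tilings are spread by spreading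 boundaries and tiles (tiles coordinatized by the path of lower corners of their boxes). A column $s$ of a tiling of $\lambda/\mu$ is eligible if $\mu$ has an up step ending at column $s$ and $\mu$'s point at column $s$ is not the top corner of a one-box tile; the special column is the rightmost eligible one. strip-grow$(T,s)$: spread $T$ at $s$, then add a one-box tile on each up step of the upper boundary from the growth site to the right boundary. ribbon-grow$(T,s)$: spread at $s$, then if the spread's special column $Q$ is right of $s$, add a ribbon of one-box tiles on top in columns strictly between $s$ and $Q$. $\operatorname{DTS}(p_1,\dots,p_n)$ (resp. $\operatorname{DTR}$) is obtained from the empty tiling by successively applying strip-grow (resp. ribbon-grow) at column $p_k-(k-1)$, $k=1,\dots,n$; $\operatorname{DTS}(\lambda,\sigma)$, $\operatorname{DTR}(\lambda,\sigma)$ apply these to the sequence of the labeled tree $(\lambda,\sigma)$, and have lower path $\lambda$.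
   Formalization: Here σ lists the chord labels from left to right, the inverse of the standardization of the left endpoints listed by label; with that standardization the claim fails at n=3: 312 avoids 231, but both maps send it to a tiling with a three-box tile. *)

theory Defs
  imports "HOL-Library.Disjoint_Sets" "HOL-Combinatorics.Permutations"
begin

section \<open>Dyck paths\<close>

datatype step = Up | Down

definition height :: "step list \<Rightarrow> int" where
  "height w = int (count_list w Up) - int (count_list w Down)"

definition dyck_word :: "step list \<Rightarrow> bool" where
  "dyck_word w \<longleftrightarrow> height w = 0 \<and> (\<forall>i\<le>length w. 0 \<le> height (take i w))"

text \<open>
  A word of length \<open>2 * n\<close> is drawn from \<open>(- n, 0)\<close> to \<open>(n, 0)\<close>; since one operation
  below acts on points, a path is also represented by its set of lattice points.
\<close>

type_synonym points = "(int \<times> int) set"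

definition path_points :: "step list \<Rightarrow> points" where
  "path_points w = {(int i - int (length w div 2), height (take i w)) | i. i \<le> length w}"

definition zigzag :: "nat \<Rightarrow> step list" where
  "zigzag n = concat (replicate n [Up, Down])"


section \<open>Dyck tiles and Dyck tilings\<close>

text \<open>
  A box is a unit square rotated by 45 degrees, identified with its lower corner: the box
  \<open>(x, y)\<close> has corners \<open>(x, y)\<close>, \<open>(x - 1, y + 1)\<close>, \<open>(x + 1, y + 1)\<close>, \<open>(x, y + 2)\<close>.
  Hence the box directly above it is \<open>(x, y + 2)\<close>, and a set of boxes is a set of points.
\<close>

definition young_diagram :: "(nat \<times> nat) set \<Rightarrow> bool" where
  "young_diagram Y \<longleftrightarrow> finite Y \<and>
     (\<forall>i j i' j'. (i, j) \<in> Y \<and> i' \<le> i \<and> j' \<le> j \<longrightarrow> (i', j') \<in> Y)"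

text \<open>
  Row \<open>i\<close>, column \<open>j\<close> of a Young diagram in matrix coordinates is drawn at
  \<open>(cx + j - i, cy - i - j)\<close>: the corner cell is on top, rows descend to the right and
  columns descend to the left.
\<close>

definition skew_shape :: "points \<Rightarrow> bool" where
  "skew_shape S \<longleftrightarrow> (\<exists>Y Y' cx cy. young_diagram Y \<and> young_diagram Y' \<and> Y' \<subseteq> Y \<and>
     S = (\<lambda>(i, j). (cx + int j - int i, cy - int i - int j)) ` (Y - Y'))"

definition adjacent :: "int \<times> int \<Rightarrow> int \<times> int \<Rightarrow> bool" where
  "adjacent b c \<longleftrightarrow> \<bar>fst b - fst c\<bar> = 1 \<and> \<bar>snd b - snd c\<bar> = 1"

definition connected_boxes :: "points \<Rightarrow> bool" where
  "connected_boxes S \<longleftrightarrow> (\<forall>b\<in>S. \<forall>c\<in>S. (b, c) \<in> {(p, q). p \<in> S \<and> q \<in> S \<and> adjacent p q}\<^sup>*)"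

definition ribbon :: "points \<Rightarrow> bool" where
  "ribbon S \<longleftrightarrow> S \<noteq> {} \<and> skew_shape S \<and> connected_boxes S \<and>
     \<not> (\<exists>x y. {(x, y), (x - 1, y + 1), (x + 1, y + 1), (x, y + 2)} \<subseteq> S)"

definition dyck_tile :: "points \<Rightarrow> bool" where
  "dyck_tile t \<longleftrightarrow> ribbon t \<and>
     (\<exists>a b h. (a, h) \<in> t \<and> (b, h) \<in> t \<and> (\<forall>(x, y)\<in>t. a \<le> x \<and> x \<le> b \<and> h \<le> y))"

record dyck_tiling =
  lower :: points
  upper :: points
  tiles :: "points set"

text \<open>The boxes of the skew shape between a lower path and an upper path.\<close>

definition boxes_between :: "points \<Rightarrow> points \<Rightarrow> points" where
  "boxes_between L M = {(x, y). \<exists>a b. (x, a) \<in> L \<and> (x, b) \<in> M \<and> a \<le> y \<and> y + 2 \<le> b \<and> even (y - a)}"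

definition is_dyck_tiling :: "dyck_tiling \<Rightarrow> bool" where
  "is_dyck_tiling T \<longleftrightarrow>
     (\<exists>l m. dyck_word l \<and> dyck_word m \<and> length l = length m \<and>
        (\<forall>i\<le>length l. height (take i l) \<le> height (take i m)) \<and>
        lower T = path_points l \<and> upper T = path_points m) \<and>
     partition_on (boxes_between (lower T) (upper T)) (tiles T) \<and>
     (\<forall>t\<in>tiles T. dyck_tile t)"

definition cover_inclusive :: "dyck_tiling \<Rightarrow> bool" where
  "cover_inclusive T \<longleftrightarrow>
     (\<forall>t\<in>tiles T. \<forall>t'\<in>tiles T. (\<exists>x y. (x, y) \<in> t \<and> (x, y + 2) \<in> t') \<longrightarrow> fst ` t' \<subseteq> fst ` t)"


section \<open>Growth processes\<close>

definition spread_points :: "int \<Rightarrow> points \<Rightarrow> points" where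
  "spread_points s P =
     {(x - 1, y) | x y. (x, y) \<in> P \<and> x \<le> s} \<union>
     {(x, y + 1) | x y. (x, y) \<in> P \<and> x = s} \<union>
     {(x + 1, y) | x y. (x, y) \<in> P \<and> s \<le> x}"

definition spread :: "dyck_tiling \<Rightarrow> int \<Rightarrow> dyck_tiling" where
  "spread T s = \<lparr>lower = spread_points s (lower T), upper = spread_points s (upper T),
     tiles = spread_points s ` tiles T\<rparr>"

text \<open>
  Stacking one-box tiles with lower corners \<open>B\<close> (points of the upper path) replaces each of
  these points of the upper path by the top corner of the new box.
\<close>

definition add_boxes :: "points \<Rightarrow> dyck_tiling \<Rightarrow> dyck_tiling" where
  "add_boxes B T = T\<lparr>upper := (upper T - B) \<union> {(x, y + 2) | x y. (x, y) \<in> B},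
     tiles := tiles T \<union> {{b} | b. b \<in> B}\<rparr>"

text \<open>
  A box sits on an up step when the step is its lower right edge, i.e. the step starts at the
  lower corner of the box. The spread creates a peak at column \<open>s\<close>; the up steps to its right
  start at columns at least \<open>s\<close>, whereas the up step into the peak starts at \<open>s - 1\<close> and
  receives no box.
\<close>

definition strip_grow :: "dyck_tiling \<Rightarrow> int \<Rightarrow> dyck_tiling" where
  "strip_grow T s = (let T' = spread T s in
     add_boxes {(x, y). (x, y) \<in> upper T' \<and> (x + 1, y + 1) \<in> upper T' \<and> s \<le> x} T')"

definition eligible :: "dyck_tiling \<Rightarrow> int \<Rightarrow> bool" where
  "eligible T c \<longleftrightarrow>
     (\<exists>y. (c - 1, y - 1) \<in> upper T \<and> (c, y) \<in> upper T \<and> {(c, y - 2)} \<notin> tiles T)"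

definition special_column :: "dyck_tiling \<Rightarrow> int" where
  "special_column T = Max {c. eligible T c}"

definition ribbon_grow :: "dyck_tiling \<Rightarrow> int \<Rightarrow> dyck_tiling" where
  "ribbon_grow T s = (let T' = spread T s; Q = special_column T' in
     if s < Q then add_boxes {(x, y). (x, y) \<in> upper T' \<and> s < x \<and> x < Q} T' else T')"

definition empty_tiling :: dyck_tiling where
  "empty_tiling = \<lparr>lower = {(0, 0)}, upper = {(0, 0)}, tiles = {}\<rparr>"

text \<open>\<open>grow g p n\<close> applies \<open>g\<close> at the columns \<open>p k - (k - 1)\<close> for \<open>k = 1, \<dots>, n\<close>.\<close>

primrec grow :: "(dyck_tiling \<Rightarrow> int \<Rightarrow> dyck_tiling) \<Rightarrow> (nat \<Rightarrow> nat) \<Rightarrow> nat \<Rightarrow> dyck_tiling" where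
  "grow g p 0 = empty_tiling"
| "grow g p (Suc k) = g (grow g p k) (int (p (Suc k)) - int k)"


section \<open>Labeled trees and the two maps\<close>

text \<open>
  In a labeled tree \<open>(w, \<sigma>)\<close> the labeling \<open>\<sigma>\<close> lists the labels of the chords of \<open>w\<close> from left to
  right: the chord starting at the \<open>c\<close>-th up step has label \<open>\<sigma> c\<close>, so the chord with label \<open>i\<close>
  starts at the up step number \<open>inv \<sigma> i\<close>, and the left endpoints listed by label are in the
  relative order of \<open>inv \<sigma>\<close>. This choice matters for the avoided pattern: if \<open>\<sigma>\<close> itself were the
  relative order of the left endpoints listed by label, 231 would turn into its inverse 312.
\<close>

definition left_end :: "step list \<Rightarrow> (nat \<Rightarrow> nat) \<Rightarrow> nat \<Rightarrow> nat" where
  "left_end w \<sigma> i = filter (\<lambda>a. w ! a = Up) [0..<length w] ! (inv \<sigma> i - 1)"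

definition matching_down :: "step list \<Rightarrow> nat \<Rightarrow> nat" where
  "matching_down w a = (LEAST b. a < b \<and> height (take (Suc b) w) = height (take a w))"

definition right_end :: "step list \<Rightarrow> (nat \<Rightarrow> nat) \<Rightarrow> nat \<Rightarrow> nat" where
  "right_end w \<sigma> i = matching_down w (left_end w \<sigma> i)"

definition insertion_sequence :: "step list \<Rightarrow> (nat \<Rightarrow> nat) \<Rightarrow> nat \<Rightarrow> nat" where
  "insertion_sequence w \<sigma> i =
     card {j \<in> {1..<i}. left_end w \<sigma> j < left_end w \<sigma> i} +
     card {j \<in> {1..<i}. right_end w \<sigma> j < left_end w \<sigma> i}"

definition DTS :: "step list \<Rightarrow> (nat \<Rightarrow> nat) \<Rightarrow> dyck_tiling" where
  "DTS w \<sigma> = grow strip_grow (insertion_sequence w \<sigma>) (length w div 2)"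

definition DTR :: "step list \<Rightarrow> (nat \<Rightarrow> nat) \<Rightarrow> dyck_tiling" where
  "DTR w \<sigma> = grow ribbon_grow (insertion_sequence w \<sigma>) (length w div 2)"

definition avoids_231 :: "nat \<Rightarrow> (nat \<Rightarrow> nat) \<Rightarrow> bool" where
  "avoids_231 n \<sigma> \<longleftrightarrow>
     \<not> (\<exists>i j k. 1 \<le> i \<and> i < j \<and> j < k \<and> k \<le> n \<and> \<sigma> k < \<sigma> i \<and> \<sigma> i < \<sigma> j)"

end

theory Submission
  imports Defs
begin

text \<open>
  For the zig-zag path the \<open>k\<close>-th growth site is \<open>2 * c k - (k - 1)\<close>, where \<open>c k\<close> counts the
  \<open>j < k\<close> to the left of \<open>k\<close> in the word of \<open>\<sigma>\<close>. The permutation avoids 231 iff these \<open>j\<close> are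
  always exactly \<open>1, \<dots>, c k\<close>, which means that every \<open>c k\<close> is a position where the upper path
  grown so far returns to height 0; then no tile is cut by the spread and all tiles stay one-box.
  A tiling by one-box tiles is determined by its upper path. If the site splits this path into
  Dyck words \<open>A\<close>, \<open>B\<close>, then strip-grow turns \<open>A B\<close> into \<open>A U B D\<close> and ribbon-grow turns it into
  \<open>A U B' D\<close>, where \<open>B = X U Y D\<close> and \<open>B' = U X D Y\<close> (\<open>B'\<close> is empty if \<open>B\<close> is). Since
  \<open>B \<mapsto> B'\<close> is a bijection of Dyck words and the decomposition \<open>A U C D\<close> of a nonempty Dyck word
  is unique, the steps can be undone: every Dyck word arises from exactly one such sequence \<open>c\<close>.
\<close>

section \<open>Dyck words\<close>

lemma height_Nil [simp]: "height [] = 0"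
  and height_Cons [simp]: "height (a # w) = (if a = Up then 1 else - 1) + height w"
  and height_append [simp]: "height (u @ v) = height u + height v"
  by (cases a; simp add: height_def)+

lemma height_take_append [simp]:
  "height (take i (u @ v)) = height (take i u) + height (take (i - length u) v)"
  by simp

text \<open>Each step changes the height by an odd amount. All parity conditions on boxes between
  two paths come down to this.\<close>

lemma even_height_iff: "even (height w) \<longleftrightarrow> even (length w)"
  by (induction w) auto

lemma dyck_word_iff: "dyck_word w \<longleftrightarrow> height w = 0 \<and> (\<forall>u v. w = u @ v \<longrightarrow> 0 \<le> height u)"
  unfolding dyck_word_def by (metis append_eq_conv_conj append_take_drop_id nat_le_linear take_all)

lemma dyck_word_height: "dyck_word w \<Longrightarrow> height w = 0"
  and dyck_word_height_take: "dyck_word w \<Longrightarrow> 0 \<le> height (take i w)"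
  and dyck_word_prefix: "dyck_word (u @ v) \<Longrightarrow> 0 \<le> height u"
    apply (simp add: dyck_word_def)
   apply (metis append_take_drop_id dyck_word_iff)
  by (metis dyck_word_iff)

lemma dyck_word_even_length: "dyck_word w \<Longrightarrow> even (length w)"
  using even_height_iff dyck_word_height by fastforce

lemma dyck_word_Nil [simp]: "dyck_word []"
  by (simp add: dyck_word_def)

lemma dyck_word_append: "dyck_word u \<Longrightarrow> dyck_word v \<Longrightarrow> dyck_word (u @ v)"
  by (simp add: dyck_word_def dyck_word_height_take)

lemma dyck_word_wrap: "dyck_word u \<Longrightarrow> dyck_word (Up # u @ [Down])"
proof -
  assume u: "dyck_word u"
  have "0 \<le> height (take i (Up # u @ [Down]))" for i
  proof (cases i)
    case (Suc j)
    then show ?thesis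
      using dyck_word_height_take[OF u, of j] dyck_word_height[OF u]
      by (cases "j - length u") auto
  qed simp
  then show ?thesis
    using u by (simp add: dyck_word_def)
qed

lemma dyck_word_splitD:
  assumes "dyck_word (u @ v)" "height u = 0"
  shows "dyck_word u" "dyck_word v"
proof -
  have "0 \<le> height (take i u)" for i
    using dyck_word_height_take[OF assms(1), of "min i (length u)"] by (simp add: min_def split: if_splits)
  then show "dyck_word u"
    using assms(2) by (simp add: dyck_word_def)
  have "0 \<le> height (take i v)" for i
    using dyck_word_height_take[OF assms(1), of "length u + i"] assms(2) by simp
  moreover have "height v = 0"
    using dyck_word_height[OF assms(1)] assms(2) by simp
  ultimately show "dyck_word v"
    by (simp add: dyck_word_def)
qed

section \<open>Decompositions of a Dyck word at its last and at its first return to height 0\<close>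

text \<open>Cut at the last visit to height 0 before the end: from there the word must go up, and it
  stays at height at least 1 until its final step.\<close>

lemma dyck_word_last_decomposition:
  assumes "dyck_word w" "w \<noteq> []"
  obtains u v where "dyck_word u" "dyck_word v" "w = u @ Up # v @ [Down]"
proof -
  define q where "q = Max {i. i < length w \<and> height (take i w) = 0}"
  have fin: "finite {i. i < length w \<and> height (take i w) = 0}"
    by simp
  \<comment> \<open>Index 0 qualifies because \<open>w\<close> is nonempty, so the maximum is
    attained.\<close>
  have "0 \<in> {i. i < length w \<and> height (take i w) = 0}"
    using assms(2) by simp
  then have q: "q < length w" "height (take q w) = 0"
    using Max_in[OF fin] unfolding q_def by blast+
  have pos: "1 \<le> height (take i w)" if "q < i" "i < length w" for i
  proof -
    have "height (take i w) \<noteq> 0"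
      using Max_ge[OF fin, of i] that unfolding q_def[symmetric] by auto
    then show ?thesis
      using dyck_word_height_take[OF assms(1), of i] by simp
  qed
  define u where "u = take q w"
  have u: "dyck_word u" "dyck_word (drop q w)"
    using dyck_word_splitD[of u "drop q w"] assms(1) q(2) by (simp_all add: u_def)
  obtain a z where a: "drop q w = a # z"
    using q(1) by (metis Cons_nth_drop_Suc)
  have w: "w = u @ a # z"
    by (simp add: u_def flip: a)
  have [simp]: "length u = q" "height u = 0"
    using q by (simp_all add: u_def)
  have "a = Up"
    using dyck_word_prefix[of "u @ [a]" z] assms(1) w by (auto split: if_splits)
  have hz: "height z = -1"
    using dyck_word_height[OF u(2)] a \<open>a = Up\<close> by simp
  then have "z \<noteq> []"
    by auto
  then obtain v b where z: "z = v @ [b]"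
    by (metis rev_exhaust)
  \<comment> \<open>The prefix of \<open>v\<close> of length \<open>i\<close> ends at index
    \<open>q + 1 + i\<close> of \<open>w\<close>, strictly between \<open>q\<close> and the end; of
    the height at least 1 there, the initial \<open>Up\<close> contributes 1.\<close>
  have pre: "0 \<le> height (take i v)" if "i \<le> length v" for i
    using pos[of "q + 1 + i"] that \<open>a = Up\<close> unfolding w z by simp
  from pre[of "length v"] have "0 \<le> height v"
    by simp
  with hz z have "b = Down" "height v = 0"
    by (auto split: if_splits) (metis step.exhaust)+
  then have "dyck_word v"
    using pre by (simp add: dyck_word_def)
  then show thesis
    using that u(1) w z \<open>a = Up\<close> \<open>b = Down\<close> by simp
qed

text \<open>If \<open>u'\<close> were longer than \<open>u\<close>, it would be \<open>u\<close>
  followed by \<open>Up\<close> and a prefix of \<open>v\<close>, hence end at height at least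
  1.\<close>

lemma dyck_word_last_decomposition_unique:
  assumes "dyck_word u" "dyck_word v" "dyck_word u'" "dyck_word v'"
    and "u @ Up # v @ [Down] = u' @ Up # v' @ [Down]"
  shows "u = u'" "v = v'"
proof -
  have le: "length u' \<le> length u"
    if d: "dyck_word u" "dyck_word v" "dyck_word u'"
      and eq: "u @ Up # v = u' @ Up # v'" for u v u' v'
  proof (rule ccontr)
    assume "\<not> length u' \<le> length u"
    then obtain z where z: "u' = u @ z" "z \<noteq> []" "Up # v = z @ Up # v'"
      using eq by (auto simp: append_eq_append_conv2)
    then obtain y where y: "z = Up # y" "v = y @ Up # v'"
      by (cases z) auto
    then have "0 \<le> height y" "height u' = height u + 1 + height y"
      using dyck_word_prefix d(2) z by auto
    then show False
      using dyck_word_height[OF d(1)] dyck_word_height[OF d(3)] by simp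
  qed
  have eq: "u @ Up # v = u' @ Up # v'"
    using assms(5) by (metis append_Cons append_assoc butlast_snoc)
  then have "length u = length u'"
    using le[OF assms(1-3) eq] le[OF assms(3,4,1) eq[symmetric]] by simp
  then show "u = u'" "v = v'"
    using eq by auto
qed

text \<open>If \<open>u'\<close> were longer than \<open>u\<close>, it would have the prefix
  \<open>u @ [Down]\<close>, which ends at height -1.\<close>

lemma dyck_word_first_decomposition_unique:
  assumes "dyck_word u" "dyck_word u'" "Up # u @ Down # v = Up # u' @ Down # v'"
  shows "u = u'" "v = v'"
proof -
  have le: "length u' \<le> length u"
    if d: "dyck_word u" "dyck_word u'" and eq: "u @ Down # v = u' @ Down # v'" for u v u' v'
  proof (rule ccontr)
    assume "\<not> length u' \<le> length u"
    then obtain z where "u' = u @ z" "z \<noteq> []" "Down # v = z @ Down # v'"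
      using eq by (auto simp: append_eq_append_conv2)
    then obtain y where "u' = (u @ [Down]) @ y"
      by (cases z) auto
    then have "0 \<le> height (u @ [Down])"
      using dyck_word_prefix d(2) by blast
    then show False
      using dyck_word_height[OF d(1)] by simp
  qed
  have eq: "u @ Down # v = u' @ Down # v'"
    using assms(3) by simp
  then have "length u = length u'"
    using le[OF assms(1,2) eq] le[OF assms(2,1) eq[symmetric]] by simp
  then show "u = u'" "v = v'"
    using eq by auto
qed

text \<open>This is the effect of a ribbon on the part of the path to the right of the growth site.\<close>

definition rotate_last :: "step list \<Rightarrow> step list" where
  "rotate_last w = (if w = [] then [] else
     (THE z. \<exists>u v. dyck_word u \<and> dyck_word v \<and> w = u @ Up # v @ [Down] \<and> z = Up # u @ Down # v))"

lemma rotate_last_Nil [simp]: "rotate_last [] = []"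
  by (simp add: rotate_last_def)

lemma rotate_last_eq:
  assumes "dyck_word u" "dyck_word v"
  shows "rotate_last (u @ Up # v @ [Down]) = Up # u @ Down # v"
  unfolding rotate_last_def
  using assms dyck_word_last_decomposition_unique[OF assms] by (auto intro!: the_equality)

lemma dyck_word_rotate_last:
  assumes "dyck_word w"
  shows "dyck_word (rotate_last w)" "length (rotate_last w) = length w"
proof -
  have "dyck_word (rotate_last w) \<and> length (rotate_last w) = length w"
  proof (cases "w = []")
    case False
    then obtain u v where uv: "dyck_word u" "dyck_word v" "w = u @ Up # v @ [Down]"
      using dyck_word_last_decomposition assms by blast
    then show ?thesis
      using dyck_word_append[OF dyck_word_wrap[OF uv(1)] uv(2)] by (simp add: rotate_last_eq)
  qed simp
  then show "dyck_word (rotate_last w)" "length (rotate_last w) = length w"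
    by auto
qed

text \<open>The image \<open>Up # u @ Down # v\<close> is a first-return decomposition, so it
  reveals \<open>u\<close> and \<open>v\<close>; the empty word is recognized by its length.\<close>

lemma inj_on_rotate_last: "inj_on rotate_last {w. dyck_word w}"
proof (rule inj_onI; clarify)
  fix w w' assume w: "dyck_word w" "dyck_word w'" and eq: "rotate_last w = rotate_last w'"
  show "w = w'"
  proof (cases "w = [] \<or> w' = []")
    case True
    then show ?thesis
      using eq w by (metis dyck_word_rotate_last(2) length_0_conv)
  next
    case False
    then obtain u v u' v' where
      "dyck_word u" "dyck_word v" "w = u @ Up # v @ [Down]"
      "dyck_word u'" "dyck_word v'" "w' = u' @ Up # v' @ [Down]"
      using dyck_word_last_decomposition w by metis
    then show ?thesis
      using eq dyck_word_first_decomposition_unique[of u u' v v'] by (simp add: rotate_last_eq)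
  qed
qed

lemma finite_dyck_words: "finite {w. dyck_word w \<and> length w = k}"
proof (rule finite_subset)
  have "finite (UNIV :: step set)"
    by (metis (full_types) finite.emptyI finite.insertI finite_subset insertCI step.exhaust subsetI)
  then show "finite {w. set w \<subseteq> (UNIV :: step set) \<and> length w = k}"
    by (rule finite_lists_length_eq)
qed auto

section \<open>Permutations avoiding 231 and their insertion codes\<close>

text \<open>As \<open>inv \<sigma> j\<close> is the position of the letter \<open>j\<close>, this is
  a variant of the inversion table of \<open>\<sigma>\<close>; it is half of the insertion sequence
  on the zig-zag.\<close>

definition insertion_code :: "(nat \<Rightarrow> nat) \<Rightarrow> nat \<Rightarrow> nat" where
  "insertion_code \<sigma> k = card {j \<in> {1..<k}. inv \<sigma> j < inv \<sigma> k}"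

text \<open>The condition makes the intervals \<open>{c k<..k}\<close> pairwise nested or
  disjoint.\<close>

definition laminar_code :: "nat \<Rightarrow> (nat \<Rightarrow> nat) \<Rightarrow> bool" where
  "laminar_code n c \<longleftrightarrow> (\<forall>k\<in>{1..n}. c k < k \<and> (\<forall>i. c k < i \<and> i < k \<longrightarrow> c k \<le> c i))"

text \<open>A downward closed set of positive integers is \<open>{1..Max S}\<close>. This lets a
  mere count, such as an insertion code, recover the set counted.\<close>

lemma downset_eq_interval:
  assumes "S \<subseteq> {1..<k::nat}" "\<And>i j. j \<in> S \<Longrightarrow> 1 \<le> i \<Longrightarrow> i \<le> j \<Longrightarrow> i \<in> S"
  shows "S = {1..card S}"
proof -
  have fin: "finite S"
    using assms(1) finite_subset by blast
  show ?thesis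
  proof (cases "S = {}")
    case False
    have "S = {1..Max S}"
    proof (intro equalityI subsetI)
      fix i assume "i \<in> S"
      then show "i \<in> {1..Max S}"
        using fin assms(1) by auto
    next
      fix i assume "i \<in> {1..Max S}"
      then show "i \<in> S"
        using assms(2) Max_in[OF fin False] by auto
    qed
    then show ?thesis
      by (metis card_atLeastAtMost diff_Suc_1)
  qed simp
qed

text \<open>Positions \<open>i < j < k\<close> and values trade places by
  \<open>x = \<sigma> k\<close>, \<open>y = \<sigma> i\<close>, \<open>z = \<sigma> j\<close>: a 231
  in \<open>\<sigma>\<close> is a 312 in its inverse.\<close>

lemma avoids_231_iff_inv:
  assumes "\<sigma> permutes {1..n}"
  shows "avoids_231 n \<sigma> \<longleftrightarrow>
    (\<forall>x y z. 1 \<le> x \<and> x < y \<and> y < z \<and> z \<le> n \<longrightarrow>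
       \<not> (inv \<sigma> y < inv \<sigma> z \<and> inv \<sigma> z < inv \<sigma> x))" (is "_ \<longleftrightarrow> ?R")
proof -
  have range: "1 \<le> \<sigma> i \<and> \<sigma> i \<le> n \<longleftrightarrow> 1 \<le> i \<and> i \<le> n"
    "1 \<le> inv \<sigma> i \<and> inv \<sigma> i \<le> n \<longleftrightarrow> 1 \<le> i \<and> i \<le> n" for i
    using permutes_in_image[OF assms, of i] permutes_in_image[OF permutes_inv[OF assms], of i]
    by auto
  show ?thesis
  proof
    assume L: "avoids_231 n \<sigma>"
    show ?R
    proof (intro allI impI notI)
      fix x y z assume "1 \<le> x \<and> x < y \<and> y < z \<and> z \<le> n" "inv \<sigma> y < inv \<sigma> z \<and> inv \<sigma> z < inv \<sigma> x"
      then have "1 \<le> inv \<sigma> y \<and> inv \<sigma> y < inv \<sigma> z \<and> inv \<sigma> z < inv \<sigma> x \<and> inv \<sigma> x \<le> n \<and>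
          \<sigma> (inv \<sigma> x) < \<sigma> (inv \<sigma> y) \<and> \<sigma> (inv \<sigma> y) < \<sigma> (inv \<sigma> z)"
        using range(2)[of x] range(2)[of y] by (simp add: permutes_inverses[OF assms])
      then show False
        using L unfolding avoids_231_def by blast
    qed
  next
    assume R: ?R
    show "avoids_231 n \<sigma>"
      unfolding avoids_231_def
    proof (intro notI, elim exE conjE)
      fix i j k assume "1 \<le> i" "i < j" "j < k" "k \<le> n" "\<sigma> k < \<sigma> i" "\<sigma> i < \<sigma> j"
      then show False
        using R[rule_format, of "\<sigma> k" "\<sigma> i" "\<sigma> j"] range(1)[of k] range(1)[of j]
        by (simp add: permutes_inverses[OF assms])
    qed
  qed
qed

text \<open>The letters below \<open>k\<close> that stand left of \<open>k\<close> form a down-set: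
  if \<open>y\<close> stands left of \<open>k\<close> and a smaller \<open>x\<close> right of it,
  then \<open>y\<close>, \<open>k\<close>, \<open>x\<close> is a 231. So these letters are
  \<open>1\<close>, ..., \<open>insertion_code \<sigma> k\<close>.\<close>

lemma inv_less_iff_le_insertion_code:
  assumes "\<sigma> permutes {1..n}" "avoids_231 n \<sigma>" "1 \<le> j" "j < k" "k \<le> n"
  shows "inv \<sigma> j < inv \<sigma> k \<longleftrightarrow> j \<le> insertion_code \<sigma> k"
proof -
  define S where "S = {j \<in> {1..<k}. inv \<sigma> j < inv \<sigma> k}"
  have "S = {1..card S}"
  proof (rule downset_eq_interval)
    fix x y assume y: "y \<in> S" and "1 \<le> x" "x \<le> y"
    show "x \<in> S"
    proof (cases "x = y")
      case False
      then have "\<not> inv \<sigma> k < inv \<sigma> x" "inv \<sigma> x \<noteq> inv \<sigma> k"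
        using assms y \<open>1 \<le> x\<close> \<open>x \<le> y\<close> permutes_inverses(1)[OF assms(1)]
          avoids_231_iff_inv[OF assms(1)]
        by (auto simp: S_def) (metis nat_less_le not_less)+
      then show ?thesis
        using y \<open>1 \<le> x\<close> \<open>x \<le> y\<close> by (simp add: S_def)
    qed (use y in simp)
  qed (auto simp: S_def)
  moreover have "j \<in> S \<longleftrightarrow> inv \<sigma> j < inv \<sigma> k"
    using assms by (simp add: S_def)
  ultimately show ?thesis
    using assms(3) unfolding insertion_code_def S_def[symmetric]
    by (metis atLeastAtMost_iff)
qed

text \<open>A letter \<open>i\<close> with \<open>insertion_code \<sigma> k < i < k\<close> stands
  right of \<open>k\<close>, while \<open>1\<close>, ..., \<open>insertion_code \<sigma> k\<close>
  stand left of \<open>k\<close>; these are smaller than \<open>i\<close> and stand left of it as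
  well.\<close>

lemma laminar_insertion_code:
  assumes "\<sigma> permutes {1..n}" "avoids_231 n \<sigma>"
  shows "laminar_code n (insertion_code \<sigma>)"
  unfolding laminar_code_def
proof (intro ballI conjI allI impI)
  fix k assume k: "k \<in> {1..n}"
  have "insertion_code \<sigma> k \<le> card {1..<k}"
    unfolding insertion_code_def by (rule card_mono) auto
  then show "insertion_code \<sigma> k < k"
    using k by auto
  fix i assume i: "insertion_code \<sigma> k < i \<and> i < k"
  have "\<not> inv \<sigma> i < inv \<sigma> k"
    using inv_less_iff_le_insertion_code[OF assms, of i k] i k by auto
  moreover have "inv \<sigma> j < inv \<sigma> k" if "1 \<le> j" "j \<le> insertion_code \<sigma> k" for j
    using inv_less_iff_le_insertion_code[OF assms, of j k] i k that by auto
  ultimately have "{1..insertion_code \<sigma> k} \<subseteq> {j \<in> {1..<i}. inv \<sigma> j < inv \<sigma> i}"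
    using i by fastforce
  then have "card {1..insertion_code \<sigma> k} \<le> insertion_code \<sigma> i"
    unfolding insertion_code_def[of _ i] by (intro card_mono) auto
  then show "insertion_code \<sigma> k \<le> insertion_code \<sigma> i"
    by simp
qed

text \<open>A value is its own rank among \<open>1\<close>, ..., \<open>n\<close>, so a permutation
  is determined by the relative order of its values.\<close>

lemma permutes_eq_card:
  assumes "\<tau> permutes {1..n}" "k \<in> {1..n}"
  shows "\<tau> k = card {j \<in> {1..n}. \<tau> j \<le> \<tau> k}"
proof -
  have "\<tau> ` {j \<in> {1..n}. \<tau> j \<le> \<tau> k} = {1..\<tau> k}"
  proof (intro equalityI subsetI)
    fix x assume "x \<in> \<tau> ` {j \<in> {1..n}. \<tau> j \<le> \<tau> k}"
    then show "x \<in> {1..\<tau> k}"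
      using permutes_in_image[OF assms(1)] by auto
  next
    fix x assume x: "x \<in> {1..\<tau> k}"
    then have "x \<in> \<tau> ` {1..n}"
      using permutes_image[OF assms(1)] permutes_in_image[OF assms(1), of k] assms(2) by auto
    then show "x \<in> \<tau> ` {j \<in> {1..n}. \<tau> j \<le> \<tau> k}"
      using x by auto
  qed
  then have "card (\<tau> ` {j \<in> {1..n}. \<tau> j \<le> \<tau> k}) = \<tau> k"
    by simp
  then show ?thesis
    using card_image[OF inj_on_subset[OF permutes_inj[OF assms(1)]]] by (metis subset_UNIV)
qed

text \<open>The code decides for every pair of letters which one stands first, and this order gives
  the positions as ranks.\<close>

lemma insertion_code_inj:
  assumes "\<sigma> permutes {1..n}" "avoids_231 n \<sigma>" "\<sigma>' permutes {1..n}" "avoids_231 n \<sigma>'"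
    and "\<And>k. k \<in> {1..n} \<Longrightarrow> insertion_code \<sigma> k = insertion_code \<sigma>' k"
  shows "\<sigma> = \<sigma>'"
proof -
  have lt: "inv \<sigma> j < inv \<sigma> k \<longleftrightarrow> inv \<sigma>' j < inv \<sigma>' k"
    if "j < k" "j \<in> {1..n}" "k \<in> {1..n}" for j k
    using that assms(5)[of k] inv_less_iff_le_insertion_code[OF assms(1,2), of j k]
      inv_less_iff_le_insertion_code[OF assms(3,4), of j k] by auto
  have inj: "inv \<sigma> j = inv \<sigma> k \<longleftrightarrow> j = k" "inv \<sigma>' j = inv \<sigma>' k \<longleftrightarrow> j = k" for j k
    using permutes_inverses(1)[OF assms(1)] permutes_inverses(1)[OF assms(3)] by metis+
  have le: "inv \<sigma> j \<le> inv \<sigma> k \<longleftrightarrow> inv \<sigma>' j \<le> inv \<sigma>' k"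
    if "j \<in> {1..n}" "k \<in> {1..n}" for j k
    using lt[of j k] lt[of k j] inj[of j k] that by (metis le_less linorder_neqE_nat not_le)
  have p: "inv \<sigma> permutes {1..n}" "inv \<sigma>' permutes {1..n}"
    using assms permutes_inv by blast+
  have "inv \<sigma> k = inv \<sigma>' k" for k
  proof (cases "k \<in> {1..n}")
    case True
    have "{j \<in> {1..n}. inv \<sigma> j \<le> inv \<sigma> k} = {j \<in> {1..n}. inv \<sigma>' j \<le> inv \<sigma>' k}"
      using le True by blast
    then show ?thesis
      using permutes_eq_card[OF p(1) True] permutes_eq_card[OF p(2) True] by simp
  next
    case False
    then show ?thesis
      using p by (simp add: permutes_def)
  qed
  then show ?thesis
    using permutes_inv_inv assms(1,3) by (metis ext)
qed

text \<open>
  \<open>code_less c j k\<close> says that the letter \<open>j\<close> stands to the left of the letter \<open>k\<close> in the permutation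
  with insertion code \<open>c\<close>.
\<close>

definition code_less :: "(nat \<Rightarrow> nat) \<Rightarrow> nat \<Rightarrow> nat \<Rightarrow> bool" where
  "code_less c j k \<longleftrightarrow> j < k \<and> j \<le> c k \<or> k < j \<and> c j < k"

text \<open>The inequalities chain directly except for the orders \<open>j < i < k\<close>,
  \<open>i < k < j\<close> and \<open>k < j < i\<close>; these are settled by laminarity at the
  largest of the three letters.\<close>

lemma code_less_trans:
  assumes "laminar_code n c" "code_less c i j" "code_less c j k"
    and "i \<in> {1..n}" "j \<in> {1..n}" "k \<in> {1..n}"
  shows "code_less c i k"
proof -
  have "c x < x" "\<And>y. c x < y \<Longrightarrow> y < x \<Longrightarrow> c x \<le> c y" if "x \<in> {1..n}" for x
    using assms(1) that unfolding laminar_code_def by auto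
  note this[OF assms(4)] this[OF assms(5)] this[OF assms(6)]
  then show ?thesis
    using assms(2,3) unfolding code_less_def
    by (smt (verit, best) le_less_trans less_le_trans linorder_not_less not_less_iff_gr_or_eq order_le_less_trans order_less_le_trans order_less_trans)
qed

lemma code_less_linear:
  assumes "j \<noteq> k"
  shows "code_less c j k \<longleftrightarrow> \<not> code_less c k j"
  using assms unfolding code_less_def by linarith

text \<open>Laminarity makes \<open>code_less c\<close> a strict linear order on the letters.
  Ranking them by it gives a permutation \<open>\<tau>\<close> of positions, whose inverse is the
  permutation sought.\<close>

lemma insertion_code_surj:
  assumes c: "laminar_code n c"
  obtains \<sigma> where "\<sigma> permutes {1..n}" "avoids_231 n \<sigma>"
    "\<And>k. k \<in> {1..n} \<Longrightarrow> insertion_code \<sigma> k = c k"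
proof -
  define below where "below k = {j \<in> {1..n}. code_less c j k}" for k
  \<comment> \<open>The rank starts at 1 because of \<open>Suc\<close>; outside
    \<open>{1..n}\<close> the map must be the identity to count as a permutation.\<close>
  define \<tau> where "\<tau> k = (if k \<in> {1..n} then Suc (card (below k)) else k)" for k
  have irrefl: "\<not> code_less c k k" for k
    by (simp add: code_less_def)
  have less: "\<tau> j < \<tau> k" if "code_less c j k" "j \<in> {1..n}" "k \<in> {1..n}" for j k
  proof -
    \<comment> \<open>The inclusion is transitivity; it is strict because \<open>j\<close> lies in
      \<open>below k\<close> but not in \<open>below j\<close>.\<close>
    have "below j \<subset> below k"
      using code_less_trans[OF c _ that(1)] irrefl that by (auto simp: below_def)
    then have "card (below j) < card (below k)"
      by (intro psubset_card_mono) (auto simp: below_def)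
    then show ?thesis
      using that by (simp add: \<tau>_def)
  qed
  have less_iff: "\<tau> j < \<tau> k \<longleftrightarrow> code_less c j k" if "j \<in> {1..n}" "k \<in> {1..n}" for j k
    using less[of j k] less[of k j] code_less_linear[of j k c] that
    by (metis irrefl less_asym less_irrefl)
  have inj: "inj_on \<tau> {1..n}"
    by (rule inj_onI) (metis code_less_linear less less_irrefl)
  have range: "\<tau> k \<in> {1..n}" if "k \<in> {1..n}" for k
  proof -
    have "below k \<subseteq> {1..n} - {k}"
      using irrefl by (auto simp: below_def)
    then have "card (below k) \<le> card ({1..n} - {k})"
      by (intro card_mono) auto
    then show ?thesis
      using that by (auto simp: \<tau>_def)
  qed
  have "\<tau> ` {1..n} = {1..n}"
    using range by (intro endo_inj_surj inj) auto
  with inj have "bij_betw \<tau> {1..n} {1..n}"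
    by (simp add: bij_betw_def)
  then have \<tau>: "\<tau> permutes {1..n}"
    by (rule bij_imp_permutes) (auto simp: \<tau>_def)
  have inv: "inv (inv \<tau>) = \<tau>"
    by (rule permutes_inv_inv[OF \<tau>])
  have p: "inv \<tau> permutes {1..n}"
    by (rule permutes_inv[OF \<tau>])
  show thesis
  proof
    show "inv \<tau> permutes {1..n}"
      by (rule p)
    \<comment> \<open>For \<open>x < y < z\<close>, having \<open>y\<close> before \<open>z\<close>
      before \<open>x\<close> would mean \<open>y \<le> c z\<close> and
      \<open>c z < x\<close>.\<close>
    show "avoids_231 n (inv \<tau>)"
      unfolding avoids_231_iff_inv[OF p] inv by (auto simp: less_iff code_less_def)
    fix k assume k: "k \<in> {1..n}"
    have "c k < k"
      using c k by (auto simp: laminar_code_def)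
    then have "{j \<in> {1..<k}. \<tau> j < \<tau> k} = {1..c k}"
      using k less_iff by (auto simp: code_less_def)
    then show "insertion_code (inv \<tau>) k = c k"
      by (simp add: insertion_code_def inv)
  qed
qed

section \<open>Growth of Dyck words\<close>

text \<open>The cut index is doubled because a Dyck word is at height 0 only at even indices. The
  map \<open>f\<close> is the identity for strips and \<open>rotate_last\<close> for
  ribbons.\<close>

primrec grow_word :: "(step list \<Rightarrow> step list) \<Rightarrow> (nat \<Rightarrow> nat) \<Rightarrow> nat \<Rightarrow> step list" where
  "grow_word f c 0 = []"
| "grow_word f c (Suc k) =
     take (2 * c (Suc k)) (grow_word f c k) @ Up # f (drop (2 * c (Suc k)) (grow_word f c k)) @ [Down]"

lemma grow_word_cong:
  "(\<And>k. k \<in> {1..n} \<Longrightarrow> c k = c' k) \<Longrightarrow> grow_word f c n = grow_word f c' n"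
  by (induction n) auto

lemma laminar_code_Suc:
  "laminar_code (Suc n) c \<longleftrightarrow>
     laminar_code n c \<and> c (Suc n) \<le> n \<and> (\<forall>i. c (Suc n) < i \<and> i \<le> n \<longrightarrow> c (Suc n) \<le> c i)"
  by (auto simp: laminar_code_def atLeastAtMostSuc_conv less_Suc_eq_le)

locale dyck_bijection =
  fixes f :: "step list \<Rightarrow> step list"
  assumes dyck: "dyck_word w \<Longrightarrow> dyck_word (f w)"
    and length: "dyck_word w \<Longrightarrow> length (f w) = length w"
    and inj: "inj_on f {w. dyck_word w}"
begin

lemma surj:
  assumes "dyck_word w"
  obtains v where "dyck_word v" "f v = w"
proof -
  have "f ` {v. dyck_word v \<and> length v = length w} = {v. dyck_word v \<and> length v = length w}"
    by (rule endo_inj_surj) (use finite_dyck_words dyck length inj in \<open>auto intro: inj_on_subset\<close>)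
  then show thesis
    using assms that by (metis (mono_tags, lifting) imageE mem_Collect_eq)
qed

text \<open>The third claim is the invariant that drives the induction: with \<open>r\<close> the
  next code value, its right-hand side is what laminarity demands, so the next cut falls at height 0
  and both parts are Dyck words.\<close>

lemma grow_word:
  assumes "laminar_code n c"
  shows "dyck_word (grow_word f c n)" "length (grow_word f c n) = 2 * n"
    "r \<le> n \<Longrightarrow> height (take (2 * r) (grow_word f c n)) = 0 \<longleftrightarrow> (\<forall>i. r < i \<and> i \<le> n \<longrightarrow> r \<le> c i)"
proof -
  have "dyck_word (grow_word f c n) \<and> length (grow_word f c n) = 2 * n \<and>
    (\<forall>r\<le>n. height (take (2 * r) (grow_word f c n)) = 0 \<longleftrightarrow> (\<forall>i. r < i \<and> i \<le> n \<longrightarrow> r \<le> c i))"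
    using assms
  proof (induction n)
    case (Suc n)
    define k where "k = c (Suc n)"
    define A where "A = take (2 * k) (grow_word f c n)"
    define B where "B = drop (2 * k) (grow_word f c n)"
    have k: "k \<le> n" "\<And>i. k < i \<Longrightarrow> i \<le> n \<Longrightarrow> k \<le> c i" and lam: "laminar_code n c"
      using Suc.prems unfolding laminar_code_Suc k_def by auto
    note IH = Suc.IH[OF lam]
    have AB: "grow_word f c n = A @ B"
      by (simp add: A_def B_def)
    have "height A = 0"
      using IH k by (simp add: A_def)
    then have dA: "dyck_word A" and dB: "dyck_word B"
      using IH dyck_word_splitD[of A B] by (simp_all add: AB)
    have lA: "length A = 2 * k" and lB: "length B = 2 * (n - k)"
      using IH k by (simp_all add: A_def B_def algebra_simps)
    have eq: "grow_word f c (Suc n) = A @ Up # f B @ [Down]"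
      by (simp add: A_def B_def k_def)
    have "height (take (2 * r) (A @ Up # f B @ [Down])) = 0 \<longleftrightarrow>
        (\<forall>i. r < i \<and> i \<le> Suc n \<longrightarrow> r \<le> c i)" if r: "r \<le> Suc n" for r
    proof -
      \<comment> \<open>The index \<open>2 * r\<close> lies in the unchanged part \<open>A\<close>,
        strictly inside the raised copy of \<open>f B\<close>, or at the end.\<close>
      consider "r \<le> k" | "k < r" "r \<le> n" | "r = Suc n"
        using r by linarith
      then show ?thesis
      proof cases
        case 1
        then have "height (take (2 * r) (A @ Up # f B @ [Down])) = height (take (2 * r) (grow_word f c n))"
          by (simp add: AB lA)
        then show ?thesis
          using IH 1 k(1) by (auto simp: k_def le_Suc_eq)
      next
        case 2
        then have "2 * r - 2 * k = Suc (2 * r - 2 * k - 1)" "2 * r - 2 * k - 1 \<le> 2 * (n - k)"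
          by linarith+
        then have "height (take (2 * r) (A @ Up # f B @ [Down])) =
            1 + height (take (2 * r - 2 * k - 1) (f B))"
          using dyck_word_height[OF dA] 2 by (simp add: lA length[OF dB] lB take_Cons')
        then have "height (take (2 * r) (A @ Up # f B @ [Down])) \<noteq> 0"
          using dyck_word_height_take[OF dyck[OF dB], of "2 * r - 2 * k - 1"] by linarith
        \<comment> \<open>The newest code value is \<open>k < r\<close>, so \<open>Suc n\<close> is
          a counterexample.\<close>
        moreover have "\<not> (\<forall>i. r < i \<and> i \<le> Suc n \<longrightarrow> r \<le> c i)"
          using 2 by (auto simp: k_def intro!: exI[of _ "Suc n"])
        ultimately show ?thesis
          by blast
      next
        case 3
        have "length (A @ Up # f B @ [Down]) \<le> 2 * r"
          using k(1) by (simp add: lA length[OF dB] lB 3)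
        then show ?thesis
          using dyck_word_height[OF dA] dyck_word_height[OF dyck[OF dB]] 3 by simp
      qed
    qed
    moreover have "dyck_word (A @ Up # f B @ [Down])"
      using dyck_word_append[OF dA dyck_word_wrap[OF dyck[OF dB]]] .
    moreover have "length (A @ Up # f B @ [Down]) = 2 * Suc n"
      using k(1) by (simp add: lA length[OF dB] lB)
    ultimately show ?case
      unfolding eq by blast
  qed simp
  then show "dyck_word (grow_word f c n)" "length (grow_word f c n) = 2 * n"
    "r \<le> n \<Longrightarrow> height (take (2 * r) (grow_word f c n)) = 0 \<longleftrightarrow> (\<forall>i. r < i \<and> i \<le> n \<longrightarrow> r \<le> c i)"
    by blast+
qed

lemma grow_word_split:
  assumes "laminar_code (Suc n) c"
  shows "dyck_word (take (2 * c (Suc n)) (grow_word f c n))"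
    "dyck_word (drop (2 * c (Suc n)) (grow_word f c n))"
    "length (take (2 * c (Suc n)) (grow_word f c n)) = 2 * c (Suc n)"
proof -
  have c: "laminar_code n c" "c (Suc n) \<le> n" "height (take (2 * c (Suc n)) (grow_word f c n)) = 0"
    using assms grow_word(3)[of n c "c (Suc n)"] unfolding laminar_code_Suc by auto
  then show "dyck_word (take (2 * c (Suc n)) (grow_word f c n))"
    "dyck_word (drop (2 * c (Suc n)) (grow_word f c n))"
    using dyck_word_splitD grow_word(1)[OF c(1)] by (metis append_take_drop_id)+
  show "length (take (2 * c (Suc n)) (grow_word f c n)) = 2 * c (Suc n)"
    using grow_word(2)[OF c(1)] c(2) by simp
qed

text \<open>The last step can be undone: the last decomposition yields \<open>A\<close> and
  \<open>f B\<close>, injectivity of \<open>f\<close> yields \<open>B\<close>, and the length of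
  \<open>A\<close> yields the last code value.\<close>

lemma grow_word_inj:
  assumes "laminar_code n c" "laminar_code n c'" "grow_word f c n = grow_word f c' n" "k \<in> {1..n}"
  shows "c k = c' k"
  using assms
proof (induction n)
  case (Suc n)
  let ?A = "take (2 * c (Suc n)) (grow_word f c n)" and ?A' = "take (2 * c' (Suc n)) (grow_word f c' n)"
  let ?B = "drop (2 * c (Suc n)) (grow_word f c n)" and ?B' = "drop (2 * c' (Suc n)) (grow_word f c' n)"
  note s = grow_word_split[OF Suc.prems(1)] and s' = grow_word_split[OF Suc.prems(2)]
  have "?A @ Up # f ?B @ [Down] = ?A' @ Up # f ?B' @ [Down]"
    using Suc.prems(3) by (simp only: grow_word.simps)
  note eq = dyck_word_last_decomposition_unique[OF s(1) dyck[OF s(2)] s'(1) dyck[OF s'(2)] this]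
  then have "?B = ?B'"
    using inj s(2) s'(2) by (simp add: inj_on_def)
  then have "grow_word f c n = grow_word f c' n"
    using eq(1) by (metis append_take_drop_id)
  moreover have "c (Suc n) = c' (Suc n)"
    using s(3) s'(3) eq(1) by simp
  moreover have "laminar_code n c" "laminar_code n c'"
    using Suc.prems(1,2) laminar_code_Suc by blast+
  moreover have "k = Suc n \<or> k \<in> {1..n}"
    using Suc.prems(4) by auto
  ultimately show ?case
    using Suc.IH by blast
qed simp

text \<open>Decompose \<open>w\<close> as \<open>A @ Up # C @ [Down]\<close>, take a preimage
  \<open>B\<close> of \<open>C\<close>, and apply the induction hypothesis to
  \<open>A @ B\<close>.\<close>

lemma grow_word_surj:
  assumes "dyck_word w" "length w = 2 * n"
  obtains c where "laminar_code n c" "grow_word f c n = w"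
  using assms
proof (induction n arbitrary: w thesis)
  case 0
  show ?case
    by (rule "0.prems"(1)[of "\<lambda>_. 0"]) (use "0.prems" in \<open>simp_all add: laminar_code_def\<close>)
next
  case (Suc n)
  have "w \<noteq> []"
    using Suc.prems by auto
  then obtain A C where AC: "dyck_word A" "dyck_word C" "w = A @ Up # C @ [Down]"
    using dyck_word_last_decomposition Suc.prems by blast
  obtain B where B: "dyck_word B" "f B = C"
    using surj[OF AC(2)] by blast
  have len: "length (A @ B) = 2 * n"
    using AC(3) Suc.prems(3) length[OF B(1)] B(2) by simp
  obtain c where c: "laminar_code n c" "grow_word f c n = A @ B"
    using Suc.IH[OF _ dyck_word_append[OF AC(1) B(1)] len] by blast
  obtain k where k: "length A = 2 * k"
    using dyck_word_even_length[OF AC(1)] by (elim evenE)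
  define c' where "c' = c(Suc n := k)"
  have "k \<le> n"
    using len k by simp
  moreover have "height (take (2 * k) (grow_word f c n)) = 0"
    using c(2) k dyck_word_height[OF AC(1)] by simp
  \<comment> \<open>The invariant is used backwards: the return to height 0 at the end of
    \<open>A\<close> makes the extended code laminar.\<close>
  ultimately have "\<forall>i. k < i \<and> i \<le> n \<longrightarrow> k \<le> c i"
    using grow_word(3)[OF c(1)] by blast
  moreover have "laminar_code n c'"
    using c(1) by (simp add: c'_def laminar_code_def)
  ultimately have "laminar_code (Suc n) c'"
    using \<open>k \<le> n\<close> by (simp add: laminar_code_Suc c'_def)
  moreover have "grow_word f c' n = A @ B"
    using c(2) grow_word_cong[of n c' c f] by (simp add: c'_def)
  then have "grow_word f c' (Suc n) = w"
    using AC B k by (simp add: c'_def)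
  ultimately show ?case
    using Suc.prems(1) by blast
qed

end

section \<open>Tilings with one-box tiles\<close>

definition one_box_tiling :: "step list \<Rightarrow> step list \<Rightarrow> dyck_tiling" where
  "one_box_tiling l m = \<lparr>lower = path_points l, upper = path_points m,
     tiles = (\<lambda>b. {b}) ` boxes_between (path_points l) (path_points m)\<rparr>"

lemma one_box_tiling_simps [simp]:
  "lower (one_box_tiling l m) = path_points l"
  "upper (one_box_tiling l m) = path_points m"
  "tiles (one_box_tiling l m) = (\<lambda>b. {b}) ` boxes_between (path_points l) (path_points m)"
  by (simp_all add: one_box_tiling_def)

lemma path_points_eq_image:
  "path_points w = (\<lambda>i. (int i - int (length w div 2), height (take i w))) ` {..length w}"
  by (auto simp: path_points_def)

lemma boxes_between_path_points:
  assumes "length l = length m"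
  shows "boxes_between (path_points l) (path_points m) =
    (\<lambda>(i, y). (int i - int (length m div 2), y)) ` {(i, y). i \<le> length m \<and>
       height (take i l) \<le> y \<and> y + 2 \<le> height (take i m) \<and> even (y - height (take i l))}"
  using assms by (auto simp: boxes_between_def path_points_def image_iff)

lemma mem_boxes_between_path_points:
  assumes "length l = length m" "i \<le> length m"
  shows "(int i - int (length m div 2), y) \<in> boxes_between (path_points l) (path_points m) \<longleftrightarrow>
    height (take i l) \<le> y \<and> y + 2 \<le> height (take i m) \<and> even (y - height (take i l))"
  using assms(2) unfolding boxes_between_path_points[OF assms(1)] by (auto simp: image_iff)

text \<open>There is one point per column, so the cardinality gives the length; consecutive heights
  then give each step.\<close>

lemma path_points_inj:
  assumes "path_points v = path_points w" "even (length v)" "even (length w)"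
  shows "v = w"
proof -
  have card: "card (path_points u) = Suc (length u)" for u
    unfolding path_points_eq_image by (subst card_image) (auto simp: inj_on_def)
  have len: "length v = length w"
    using card[of v] card[of w] assms(1) by simp
  have h: "height (take i v) = height (take i w)" if "i \<le> length w" for i
  proof -
    have "(int i - int (length v div 2), height (take i v)) \<in> path_points w"
      using that len unfolding assms(1)[symmetric] by (auto simp: path_points_def)
    then show ?thesis
      using len by (auto simp: path_points_def)
  qed
  show ?thesis
  proof (rule nth_equalityI[OF len])
    fix i assume "i < length v"
    then show "v ! i = w ! i"
      using h[of i] h[of "Suc i"] len
      by (cases "v ! i"; cases "w ! i") (simp_all add: take_Suc_conv_app_nth)
  qed
qed

text \<open>The point at index \<open>length u\<close> gets a left, a raised and a right copy, which
  together form an inserted peak. The path grows by 2, so its start moves left by 1.\<close>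

lemma spread_points_path_points:
  assumes "even (length (u @ v))"
  shows "spread_points (int (length u) - int (length (u @ v) div 2)) (path_points (u @ v)) =
    path_points (u @ Up # Down # v)"
proof -
  let ?k = "length (u @ v) div 2" and ?w = "u @ Up # Down # v"
  have half: "length ?w div 2 = Suc ?k"
    by simp
  have split: "{..length ?w} = {..length u} \<union> {Suc (length u)} \<union> (\<lambda>i. i + 2) ` {length u..length (u @ v)}"
    by (simp only: image_add_atLeastAtMost') auto
  have left: "{(x - 1, y) | x y. (x, y) \<in> path_points (u @ v) \<and> x \<le> int (length u) - int ?k} =
      (\<lambda>i. (int i - int (Suc ?k), height (take i ?w))) ` {..length u}"
    by (auto simp: path_points_def image_def)
  have mid: "{(x, y + 1) | x y. (x, y) \<in> path_points (u @ v) \<and> x = int (length u) - int ?k} =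
      (\<lambda>i. (int i - int (Suc ?k), height (take i ?w))) ` {Suc (length u)}"
    by (auto simp: path_points_def image_def Suc_diff_le)
  have right: "{(x + 1, y) | x y. (x, y) \<in> path_points (u @ v) \<and> int (length u) - int ?k \<le> x} =
      (\<lambda>i. (int i - int (Suc ?k), height (take i ?w))) ` (\<lambda>i. i + 2) ` {length u..length (u @ v)}"
  proof -
    have "{(x + 1, y) | x y. (x, y) \<in> path_points (u @ v) \<and> int (length u) - int ?k \<le> x} =
        (\<lambda>i. (int i - int ?k + 1, height (take i (u @ v)))) ` {length u..length (u @ v)}"
      unfolding path_points_def by fastforce
    also have "\<dots> = (\<lambda>i. (int i - int (Suc ?k), height (take i ?w))) ` (\<lambda>i. i + 2) ` {length u..length (u @ v)}"
      unfolding image_image by (rule image_cong) (auto simp: Suc_diff_le)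
    finally show ?thesis .
  qed
  show ?thesis
    unfolding spread_points_def left mid right path_points_eq_image[of ?w] half split image_Un ..
qed

lemma raise_path_points:
  assumes len: "length m' = length m"
    and h: "\<And>i. i \<le> length m \<Longrightarrow> height (take i m') = height (take i m) + (if i \<in> I then 2 else 0)"
    and B: "B = (\<lambda>i. (int i - int (length m div 2), height (take i m))) ` (I \<inter> {..length m})"
  shows "(path_points m - B) \<union> {(x, y + 2) | x y. (x, y) \<in> B} = path_points m'"
  unfolding B path_points_eq_image[of m] path_points_eq_image[of m'] len
  using h by (auto simp: image_iff)

text \<open>Raising the upper path by 2 in a column leaves room for exactly one more box there,
  whose lower corner is the old path point.\<close>

lemma boxes_between_raise:
  assumes len: "length l = length m" "length m' = length m"
    and le: "\<And>i. i \<le> length m \<Longrightarrow> height (take i l) \<le> height (take i m)"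
    and h: "\<And>i. i \<le> length m \<Longrightarrow> height (take i m') = height (take i m) + (if i \<in> I then 2 else 0)"
    and B: "B = (\<lambda>i. (int i - int (length m div 2), height (take i m))) ` (I \<inter> {..length m})"
  shows "boxes_between (path_points l) (path_points m') = boxes_between (path_points l) (path_points m) \<union> B"
proof -
  have parity: "even (height (take i m) - height (take i l))" if "i \<le> length m" for i
    using that len even_height_iff by simp
  \<comment> \<open>One column in isolation: \<open>a\<close> is the lower height, \<open>b\<close>
    and \<open>b'\<close> the old and new upper heights, and \<open>P\<close> says that a box is
    stacked.\<close>
  have top: "a \<le> y \<and> y + 2 \<le> b' \<and> even (y - a) \<longleftrightarrow>
      a \<le> y \<and> y + 2 \<le> b \<and> even (y - a) \<or> P \<and> y = b"
    if "a \<le> b" "even (b - a)" "b' = b + (if P then 2 else 0)" for a b b' y :: int and P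
    using that by (cases P) (simp_all, presburger+)
  have "{(i, y). i \<le> length m \<and> height (take i l) \<le> y \<and>
       y + 2 \<le> height (take i m') \<and> even (y - height (take i l))} =
     {(i, y). i \<le> length m \<and> height (take i l) \<le> y \<and>
       y + 2 \<le> height (take i m) \<and> even (y - height (take i l))} \<union>
     {(i, y). i \<in> I \<and> i \<le> length m \<and> y = height (take i m)}"
    (is "?L = ?R")
  proof (rule set_eqI)
    fix p :: "nat \<times> int"
    obtain i y where p: "p = (i, y)"
      by (cases p)
    show "p \<in> ?L \<longleftrightarrow> p \<in> ?R"
    proof (cases "i \<le> length m")
      case True
      show ?thesis
        unfolding p Un_iff mem_Collect_eq case_prod_conv
        using top[OF le[OF True] parity[OF True] h[OF True], of y] True by blast
    qed (simp add: p)
  qed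
  moreover have "B = (\<lambda>(i, y). (int i - int (length m div 2), y)) `
      {(i, y). i \<in> I \<and> i \<le> length m \<and> y = height (take i m)}"
    unfolding B by (auto simp: image_iff)
  ultimately show ?thesis
    unfolding boxes_between_path_points[OF len(1)]
      boxes_between_path_points[OF trans[OF len(1) len(2)[symmetric]]] len(2)
    by (simp only: image_Un)
qed

lemma add_boxes_one_box_tiling:
  assumes "length l = length m" "length m' = length m"
    and "\<And>i. i \<le> length m \<Longrightarrow> height (take i l) \<le> height (take i m)"
    and "\<And>i. i \<le> length m \<Longrightarrow> height (take i m') = height (take i m) + (if i \<in> I then 2 else 0)"
    and "B = (\<lambda>i. (int i - int (length m div 2), height (take i m))) ` (I \<inter> {..length m})"
  shows "add_boxes B (one_box_tiling l m) = one_box_tiling l m'"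
proof -
  have "{{b} | b. b \<in> B} = (\<lambda>b. {b}) ` B"
    by auto
  then show ?thesis
    by (simp add: add_boxes_def one_box_tiling_def raise_path_points[OF assms(2,4,5)]
        boxes_between_raise[OF assms] image_Un)
qed

text \<open>The two paths meet at the growth site, so no box lies in its column; every box is merely
  translated and stays a single box.\<close>

lemma spread_one_box_tiling:
  assumes len: "even (length (u @ v))" "length u' = length u" "length v' = length v"
    and h: "height u' = height u"
  shows "spread (one_box_tiling (u' @ v') (u @ v)) (int (length u) - int (length (u @ v) div 2)) =
    one_box_tiling (u' @ Up # Down # v') (u @ Up # Down # v)"
proof -
  let ?k = "length (u @ v) div 2"
  define s where "s = int (length u) - int ?k"
  define shift where "shift x = (if x < s then x - 1 else x + 1)" for x
  let ?l = "u' @ v'" and ?m = "u @ v" and ?l' = "u' @ Up # Down # v'" and ?m' = "u @ Up # Down # v"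
  define S where "S = boxes_between (path_points ?l) (path_points ?m)"
  have "fst b \<noteq> s" if "b \<in> S" for b
    using that len h unfolding S_def s_def by (subst (asm) boxes_between_path_points) auto
  then have single: "spread_points s {b} = {(shift (fst b), snd b)}" if "b \<in> S" for b
    using that by (cases b) (fastforce simp: spread_points_def shift_def)
  define X where "X = {(i, y). i \<le> length ?m \<and> height (take i ?l) \<le> y \<and>
       y + 2 \<le> height (take i ?m) \<and> even (y - height (take i ?l))}"
  define X' where "X' = {(i, y). i \<le> length ?m' \<and> height (take i ?l') \<le> y \<and>
       y + 2 \<le> height (take i ?m') \<and> even (y - height (take i ?l'))}"
  have S: "S = (\<lambda>(i, y). (int i - int ?k, y)) ` X"
    unfolding S_def X_def by (rule boxes_between_path_points) (simp add: len)
  have "boxes_between (path_points ?l') (path_points ?m') =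
      (\<lambda>(i, y). (int i - int (length ?m' div 2), y)) ` X'"
    unfolding X'_def by (rule boxes_between_path_points) (simp add: len)
  \<comment> \<open>Old indices from \<open>length u\<close> on move by 2. The new shape has no box
    at the indices \<open>length u\<close> and \<open>Suc (length u)\<close>, where the two spread
    paths still touch.\<close>
  also have "X' = (\<lambda>(i, y). (if i < length u then i else i + 2, y)) ` X"
  proof (intro equalityI subsetI)
    fix p assume "p \<in> X'"
    then obtain i y where p: "p = (i, y)" "(i, y) \<in> X'"
      by (cases p) auto
    consider "i < length u" | "i = length u" | "i = Suc (length u)" | "length u + 2 \<le> i"
      by linarith
    then show "p \<in> (\<lambda>(i, y). (if i < length u then i else i + 2, y)) ` X"
    proof cases
      case 1
      then have "(i, y) \<in> X"
        using p(2) len by (simp add: X_def X'_def)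
      then show ?thesis
        using 1 p(1) by force
    next
      case 4
      define j where "j = i - 2"
      have j: "i = j + 2" "length u \<le> j"
        using 4 by (simp_all add: j_def)
      then have "(j, y) \<in> X"
        using p(2) len h by (simp add: X_def X'_def Suc_diff_le)
      then show ?thesis
        using j p(1) by force
    qed (use p(2) len h in \<open>auto simp: X'_def\<close>)
  next
    fix p assume "p \<in> (\<lambda>(i, y). (if i < length u then i else i + 2, y)) ` X"
    then obtain i y where "(i, y) \<in> X" "p = (if i < length u then i else i + 2, y)"
      by auto
    then show "p \<in> X'"
      using len h by (auto simp: X_def X'_def Suc_diff_le)
  qed
  finally have "boxes_between (path_points ?l') (path_points ?m') = (\<lambda>(x, y). (shift x, y)) ` S"
    unfolding S image_image by (auto simp: shift_def s_def intro!: image_cong)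
  then have "spread_points s ` (\<lambda>b. {b}) ` S = (\<lambda>b. {b}) ` boxes_between (path_points ?l') (path_points ?m')"
    using single by (simp add: image_image split_beta)
  moreover have "spread_points s (path_points ?l) = path_points ?l'"
    using spread_points_path_points[of u' v'] len by (simp add: s_def)
  moreover have "spread_points s (path_points ?m) = path_points ?m'"
    using spread_points_path_points[of u v] len by (simp add: s_def)
  ultimately show ?thesis
    by (simp add: spread_def one_box_tiling_def S_def s_def)
qed

section \<open>The zig-zag path as lower boundary\<close>

lemma zigzag_0 [simp]: "zigzag 0 = []"
  and zigzag_Suc [simp]: "zigzag (Suc n) = Up # Down # zigzag n"
  by (simp_all add: zigzag_def)

lemma zigzag_add: "zigzag (m + n) = zigzag m @ zigzag n"
  by (simp add: zigzag_def replicate_add)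

lemma length_zigzag [simp]: "length (zigzag n) = 2 * n"
  by (induction n) simp_all

lemma height_take_zigzag: "i \<le> 2 * n \<Longrightarrow> height (take i (zigzag n)) = int (i mod 2)"
proof (induction n arbitrary: i)
  case (Suc n)
  consider "i = 0" | "i = 1" | j where "i = Suc (Suc j)"
    by (metis One_nat_def not0_implies_Suc)
  then show ?case
    using Suc by cases auto
qed simp

lemma height_zigzag [simp]: "height (zigzag n) = 0"
  by (induction n) simp_all

lemma dyck_word_zigzag: "dyck_word (zigzag n)"
  by (simp add: dyck_word_def height_take_zigzag)

text \<open>The zig-zag has height \<open>i mod 2\<close>, the least nonnegative number of the
  parity forced at index \<open>i\<close>.\<close>

lemma zigzag_le:
  assumes "dyck_word w" "length w = 2 * n" "i \<le> 2 * n"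
  shows "height (take i (zigzag n)) \<le> height (take i w)"
proof -
  have "even (height (take i w)) \<longleftrightarrow> even i"
    using even_height_iff[of "take i w"] assms by simp
  moreover have "0 \<le> height (take i w)"
    by (rule dyck_word_height_take[OF assms(1)])
  ultimately show ?thesis
    unfolding height_take_zigzag[OF assms(3)] by (cases "even i") (auto simp: odd_iff_mod_2_eq_one, presburger)
qed

lemma spread_zigzag:
  assumes "dyck_word u" "dyck_word v" "length (u @ v) = 2 * n"
  shows "spread (one_box_tiling (zigzag n) (u @ v)) (int (length u) - int n) =
    one_box_tiling (zigzag (Suc n)) (u @ Up # Down # v)"
proof -
  obtain a b where ab: "length u = 2 * a" "length v = 2 * b"
    using dyck_word_even_length assms(1,2) by (metis evenE)
  then have n: "n = a + b"
    using assms(3) by simp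
  have "zigzag (Suc n) = zigzag a @ Up # Down # zigzag b"
    using zigzag_add[of a "Suc b"] by (simp add: n flip: zigzag_Suc)
  moreover have "spread (one_box_tiling (zigzag n) (u @ v)) (int (length u) - int n) =
      one_box_tiling (zigzag a @ Up # Down # zigzag b) (u @ Up # Down # v)"
    using spread_one_box_tiling[of u v "zigzag a" "zigzag b"] ab dyck_word_height[OF assms(1)]
    by (simp add: n zigzag_add)
  ultimately show ?thesis
    by (simp only:)
qed

section \<open>One growth step above the zig-zag\<close>

lemma up_step_iff:
  "(x, y) \<in> path_points w \<and> (x + 1, y + 1) \<in> path_points w \<longleftrightarrow>
    (\<exists>i<length w. w ! i = Up \<and> x = int i - int (length w div 2) \<and> y = height (take i w))"
proof
  assume "(x, y) \<in> path_points w \<and> (x + 1, y + 1) \<in> path_points w"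
  then obtain i j where i: "x = int i - int (length w div 2)" "y = height (take i w)"
    and j: "x + 1 = int j - int (length w div 2)" "y + 1 = height (take j w)" "j \<le> length w"
    unfolding path_points_def by blast
  then have "j = Suc i"
    by linarith
  then have "i < length w" "height (take (Suc i) w) = height (take i w) + 1"
    using i j unfolding \<open>j = Suc i\<close> by auto
  then show "\<exists>i<length w. w ! i = Up \<and> x = int i - int (length w div 2) \<and> y = height (take i w)"
    using i by (intro exI[of _ i]) (simp add: take_Suc_conv_app_nth split: if_splits)
next
  assume "\<exists>i<length w. w ! i = Up \<and> x = int i - int (length w div 2) \<and> y = height (take i w)"
  then obtain i where i: "i < length w" "w ! i = Up" "x = int i - int (length w div 2)" "y = height (take i w)"
    by blast
  then have "x + 1 = int (Suc i) - int (length w div 2)" "y + 1 = height (take (Suc i) w)"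
    by (simp_all add: take_Suc_conv_app_nth)
  moreover have "i \<le> length w" "Suc i \<le> length w"
    using i(1) by simp_all
  ultimately show "(x, y) \<in> path_points w \<and> (x + 1, y + 1) \<in> path_points w"
    unfolding path_points_def using i(3,4) by blast
qed

text \<open>Beyond the peak, the new path at index \<open>length u + 2 + j\<close> has read one more
  letter of \<open>v\<close> than the spread path and lies one higher: the gain is 2 if that letter
  is \<open>Up\<close> and 0 if it is \<open>Down\<close>.\<close>

lemma strip_grow_zigzag:
  assumes u: "dyck_word u" and v: "dyck_word v" and len: "length (u @ v) = 2 * n"
  shows "strip_grow (one_box_tiling (zigzag n) (u @ v)) (int (length u) - int n) =
    one_box_tiling (zigzag (Suc n)) (u @ Up # v @ [Down])"
proof -
  define m where "m = u @ Up # Down # v"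
  \<comment> \<open>In the path of order \<open>Suc n\<close> the growth site is index
    \<open>length u + 1\<close>, the peak; the strict bound leaves out the up step into it.\<close>
  define I where "I = {i. length u < i \<and> i < length m \<and> m ! i = Up}"
  have m: "length m = 2 * Suc n" "dyck_word m"
    using len dyck_word_append[OF u dyck_word_append[OF dyck_word_wrap[OF dyck_word_Nil] v]]
    by (simp_all add: m_def)
  have "{(x, y). (x, y) \<in> path_points m \<and> (x + 1, y + 1) \<in> path_points m \<and> int (length u) - int n \<le> x} =
      (\<lambda>i. (int i - int (length m div 2), height (take i m))) ` (I \<inter> {..length m})" (is "?B = _")
  proof -
    have "?B = {(x, y). \<exists>i<length m. m ! i = Up \<and> x = int i - int (length m div 2) \<and>
        y = height (take i m) \<and> int (length u) - int n \<le> x}"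
      using up_step_iff[of _ _ m] by blast
    then show ?thesis
      unfolding I_def m(1) by auto
  qed
  moreover have "height (take i (u @ Up # v @ [Down])) = height (take i m) + (if i \<in> I then 2 else 0)"
    if "i \<le> length m" for i
  proof -
    consider "i \<le> length u" | "i = Suc (length u)" | "length u + 2 \<le> i"
      by linarith
    then show ?thesis
    proof cases
      case 3
      define j where "j = i - (length u + 2)"
      have j: "i = length u + 2 + j" "j \<le> length v"
        using 3 that by (simp_all add: j_def m_def)
      show ?thesis
      proof (cases "j < length v")
        case True
        then show ?thesis
          using j by (cases "v ! j") (simp_all add: I_def m_def take_Suc_conv_app_nth nth_append)
      next
        case False
        then show ?thesis
          using j by (simp add: I_def m_def)
      qed
    qed (auto simp: I_def m_def nth_append)
  qed
  ultimately show ?thesis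
    unfolding strip_grow_def Let_def spread_zigzag[OF assms] m_def[symmetric] one_box_tiling_simps
    using len zigzag_le[OF m(2,1)] m(1)
    by (intro add_boxes_one_box_tiling[where I = I]) simp_all
qed

text \<open>Below the end of an up step at height \<open>y\<close> there is a box of the shape
  unless \<open>y = 1\<close>, and all tiles have one box. So only up steps leaving height 0
  count.\<close>

lemma eligible_zigzag_iff:
  assumes "dyck_word m" "length m = 2 * n"
  shows "eligible (one_box_tiling (zigzag n) m) c \<longleftrightarrow>
    (\<exists>i<2 * n. m ! i = Up \<and> height (take i m) = 0 \<and> c = int (Suc i) - int n)"
proof -
  have half: "length m div 2 = n"
    using assms(2) by simp
  have tile: "(c, y - 2) \<notin> boxes_between (path_points (zigzag n)) (path_points m) \<longleftrightarrow> y = 1"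
    if i: "i < length m" "m ! i = Up" "c - 1 = int i - int n" "y - 1 = height (take i m)" for i y
  proof -
    have si: "c = int (Suc i) - int n" "y = height (take (Suc i) m)" "Suc i \<le> 2 * n"
      using i assms(2) by (simp_all add: take_Suc_conv_app_nth)
    have par: "even y \<longleftrightarrow> even (Suc i)"
      using even_height_iff[of "take (Suc i) m"] si assms(2) by simp
    have pos: "1 \<le> y"
      using dyck_word_height_take[OF assms(1), of i] i by linarith
    have "(c, y - 2) \<in> boxes_between (path_points (zigzag n)) (path_points m) \<longleftrightarrow>
        int (Suc i mod 2) \<le> y - 2 \<and> even (y - 2 - int (Suc i mod 2))"
      using mem_boxes_between_path_points[of "zigzag n" m "Suc i" "y - 2"] si assms(2)
      by (simp add: height_take_zigzag)
    also have "\<dots> \<longleftrightarrow> y \<noteq> 1"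
      using pos par by presburger
    finally show ?thesis
      by simp
  qed
  have "eligible (one_box_tiling (zigzag n) m) c \<longleftrightarrow>
      (\<exists>y. ((c - 1, y - 1) \<in> path_points m \<and> (c - 1 + 1, y - 1 + 1) \<in> path_points m) \<and>
         (c, y - 2) \<notin> boxes_between (path_points (zigzag n)) (path_points m))"
    by (auto simp: eligible_def)
  also have "\<dots> \<longleftrightarrow> (\<exists>y. \<exists>i<length m. m ! i = Up \<and> c - 1 = int i - int n \<and> y - 1 = height (take i m) \<and> y = 1)"
    unfolding up_step_iff half using tile by blast
  also have "\<dots> \<longleftrightarrow> (\<exists>i<2 * n. m ! i = Up \<and> height (take i m) = 0 \<and> c = int (Suc i) - int n)"
    using assms(2) by force
  finally show ?thesis .
qed

text \<open>After the step \<open>Up\<close> following \<open>u\<close> the path returns to height 0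
  only at its end, so this is the last up step leaving height 0. The column is that of its endpoint,
  hence \<open>Suc\<close>.\<close>

lemma special_column_zigzag:
  assumes "dyck_word u" "dyck_word v" "length (u @ Up # v @ [Down]) = 2 * n"
  shows "special_column (one_box_tiling (zigzag n) (u @ Up # v @ [Down])) = int (Suc (length u)) - int n"
  unfolding special_column_def
proof (rule Max_eqI)
  let ?m = "u @ Up # v @ [Down]"
  have "dyck_word ?m"
    using dyck_word_append[OF assms(1) dyck_word_wrap[OF assms(2)]] .
  note el = eligible_zigzag_iff[OF this assms(3)]
  show "finite {c. eligible (one_box_tiling (zigzag n) ?m) c}"
    unfolding el by (rule finite_subset[of _ "(\<lambda>i. int (Suc i) - int n) ` {..<2 * n}"]) auto
  show "int (Suc (length u)) - int n \<in> {c. eligible (one_box_tiling (zigzag n) ?m) c}"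
    unfolding el mem_Collect_eq using assms(3) dyck_word_height[OF assms(1)]
    by (intro exI[of _ "length u"]) (simp add: nth_append)
  fix c assume "c \<in> {c. eligible (one_box_tiling (zigzag n) ?m) c}"
  then obtain i where i: "i < 2 * n" "height (take i ?m) = 0" "c = int (Suc i) - int n"
    unfolding el by blast
  have "i \<le> length u"
  proof (rule ccontr)
    assume "\<not> i \<le> length u"
    then obtain j where j: "i = Suc (length u + j)"
      using less_imp_Suc_add not_le by blast
    then have "height (take i ?m) = 1 + height (take j v)"
      using i(1) assms(3) dyck_word_height[OF assms(1)] by simp
    then show False
      using i(2) dyck_word_height_take[OF assms(2), of j] by simp
  qed
  then show "c \<le> int (Suc (length u)) - int n"
    using i(3) by simp
qed

text \<open>With \<open>v = a @ Up # b @ [Down]\<close>, the ribbon lifts the portion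
  \<open>a\<close> by 2, which turns the \<open>Down\<close> before it into \<open>Up\<close> and
  the \<open>Up\<close> after it into \<open>Down\<close>; this replaces \<open>v\<close> by
  \<open>rotate_last v\<close>.\<close>

lemma ribbon_grow_zigzag:
  assumes u: "dyck_word u" and v: "dyck_word v" and len: "length (u @ v) = 2 * n"
  shows "ribbon_grow (one_box_tiling (zigzag n) (u @ v)) (int (length u) - int n) =
    one_box_tiling (zigzag (Suc n)) (u @ Up # rotate_last v @ [Down])"
proof (cases "v = []")
  case True
  \<comment> \<open>For empty \<open>v\<close> the special column is the growth site itself, so no
    ribbon is added.\<close>
  then have "special_column (one_box_tiling (zigzag (Suc n)) (u @ Up # Down # v)) = int (length u) - int n"
    using special_column_zigzag[OF u dyck_word_Nil, of "Suc n"] len by simp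
  then show ?thesis
    unfolding ribbon_grow_def Let_def spread_zigzag[OF assms] by (simp add: True)
next
  case False
  obtain a b where ab: "dyck_word a" "dyck_word b" "v = a @ Up # b @ [Down]"
    using dyck_word_last_decomposition[OF v False] by blast
  define m where "m = u @ Up # Down # v"
  define m' where "m' = u @ Up # rotate_last v @ [Down]"
  \<comment> \<open>Both ends are excluded: the peak at the growth site, and the end of the
    \<open>Up\<close> following \<open>a\<close>, which is the special column.\<close>
  define I where "I = {length u + 1<..<length u + length a + 3}"
  have m: "length m = 2 * Suc n" "dyck_word m"
    using len dyck_word_append[OF u dyck_word_append[OF dyck_word_wrap[OF dyck_word_Nil] v]]
    by (simp_all add: m_def)
  have Q: "special_column (one_box_tiling (zigzag (Suc n)) m) = int (length u + length a + 3) - int (Suc n)"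
    using special_column_zigzag[of "u @ Up # Down # a" b "Suc n"] len ab(2)
      dyck_word_append[OF u dyck_word_append[OF dyck_word_wrap[OF dyck_word_Nil] ab(1)]]
    by (simp add: m_def ab(3))
  have "{(x, y). (x, y) \<in> path_points m \<and> int (length u) - int n < x \<and>
        x < int (length u + length a + 3) - int (Suc n)} =
      (\<lambda>i. (int i - int (length m div 2), height (take i m))) ` (I \<inter> {..length m})"
    unfolding path_points_def m(1) I_def by auto
  moreover have "height (take i m') = height (take i m) + (if i \<in> I then 2 else 0)" for i
  proof -
    have m': "m' = u @ Up # Up # a @ Down # b @ [Down]"
      using rotate_last_eq[OF ab(1,2)] by (simp add: m'_def ab(3))
    consider "i \<le> length u + 1" | "length u + 1 < i" "i < length u + length a + 3"
      | "length u + length a + 3 \<le> i"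
      by linarith
    then show ?thesis
    proof cases
      case 1
      then show ?thesis
        by (simp add: m' m_def I_def take_Cons')
    next
      case 2
      define j where "j = i - (length u + 2)"
      have "i = length u + 2 + j" "j \<le> length a"
        using 2 by (simp_all add: j_def)
      then show ?thesis
        by (simp add: m' m_def ab(3) I_def)
    next
      case 3
      define j where "j = i - (length u + length a + 3)"
      have "i = length u + Suc (Suc (Suc (length a + j)))"
        using 3 by (simp add: j_def)
      then show ?thesis
        by (simp add: m' m_def ab(3) I_def numeral_3_eq_3)
    qed
  qed
  moreover have "length m' = length m"
    by (simp add: m'_def m_def dyck_word_rotate_last[OF v])
  moreover have "int (length u) - int n < int (length u + length a + 3) - int (Suc n)"
    by simp
  ultimately show ?thesis
    unfolding ribbon_grow_def Let_def spread_zigzag[OF assms] m_def[symmetric] m'_def[symmetric]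
      one_box_tiling_simps Q
    using zigzag_le[OF m(2,1)] m(1)
    by (simp only: if_True, intro add_boxes_one_box_tiling[where I = I]) simp_all
qed

section \<open>Dyck tilings of the zig-zag with one-box tiles only\<close>

lemma dyck_tile_singleton: "dyck_tile {b}"
proof -
  obtain x y where b: "b = (x, y)"
    by (cases b)
  have "skew_shape {b}"
    unfolding skew_shape_def b young_diagram_def
    by (intro exI[of _ "{(0, 0)}"] exI[of _ "{}"] exI[of _ x] exI[of _ y]) auto
  then have "ribbon {b}"
    by (auto simp: ribbon_def connected_boxes_def)
  then show ?thesis
    unfolding dyck_tile_def b by auto
qed

lemma one_box_tiling_inj:
  assumes "one_box_tiling l v = one_box_tiling l w" "dyck_word v" "dyck_word w"
  shows "v = w"
  using assms path_points_inj dyck_word_even_length by (metis one_box_tiling_simps(2))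

text \<open>A partition into singletons must consist of all singletons, so such a tiling is fixed by
  its upper path, and every Dyck word of the right length can serve as one.\<close>

lemma zigzag_one_box_tilings:
  "{T. is_dyck_tiling T \<and> cover_inclusive T \<and> lower T = path_points (zigzag n) \<and>
      (\<forall>t\<in>tiles T. card t = 1)} =
   one_box_tiling (zigzag n) ` {w. dyck_word w \<and> length w = 2 * n}" (is "?L = ?R")
proof (intro equalityI subsetI)
  fix T assume T: "T \<in> ?L"
  then obtain l m where lm: "dyck_word l" "dyck_word m" "length l = length m"
      "lower T = path_points l" "upper T = path_points m"
    and part: "partition_on (boxes_between (lower T) (upper T)) (tiles T)"
    and card: "\<And>t. t \<in> tiles T \<Longrightarrow> card t = 1" and low: "lower T = path_points (zigzag n)"
    unfolding is_dyck_tiling_def by blast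
  have "l = zigzag n"
    using lm(1,4) low dyck_word_even_length by (intro path_points_inj) auto
  moreover have "tiles T = (\<lambda>b. {b}) ` boxes_between (lower T) (upper T)"
  proof (intro equalityI subsetI)
    fix t assume t: "t \<in> tiles T"
    then obtain b where "t = {b}"
      using card card_1_singletonE by blast
    then show "t \<in> (\<lambda>b. {b}) ` boxes_between (lower T) (upper T)"
      using t partition_onD1[OF part] by blast
  next
    fix t assume "t \<in> (\<lambda>b. {b}) ` boxes_between (lower T) (upper T)"
    then obtain b t' where "t = {b}" "t' \<in> tiles T" "b \<in> t'"
      using partition_onD1[OF part] by blast
    then show "t \<in> tiles T"
      using card card_1_singletonE by (metis singletonD)
  qed
  ultimately have "T = one_box_tiling (zigzag n) m"
    using lm by (intro dyck_tiling.equality) simp_all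
  then show "T \<in> ?R"
    using lm \<open>l = zigzag n\<close> by auto
next
  fix T assume "T \<in> ?R"
  then obtain w where w: "dyck_word w" "length w = 2 * n" and T: "T = one_box_tiling (zigzag n) w"
    by blast
  have "is_dyck_tiling T"
    unfolding is_dyck_tiling_def
  proof (intro conjI)
    show "\<exists>l m. dyck_word l \<and> dyck_word m \<and> length l = length m \<and>
        (\<forall>i\<le>length l. height (take i l) \<le> height (take i m)) \<and>
        lower T = path_points l \<and> upper T = path_points m"
      using w zigzag_le[OF w] dyck_word_zigzag
      by (intro exI[of _ "zigzag n"] exI[of _ w]) (simp add: T)
    show "partition_on (boxes_between (lower T) (upper T)) (tiles T)"
      by (auto simp: T partition_on_def disjoint_def)
    show "\<forall>t\<in>tiles T. dyck_tile t"
      by (auto simp: T dyck_tile_singleton)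
  qed
  \<comment> \<open>A box directly above another lies in the same column, so one-box tiles have
    equal extents.\<close>
  moreover have "cover_inclusive T"
    by (auto simp: T cover_inclusive_def)
  ultimately show "T \<in> ?L"
    by (simp add: T)
qed

section \<open>Insertion sequences of labelings of the zig-zag\<close>

lemma filter_Up_zigzag: "filter (\<lambda>a. zigzag n ! a = Up) [0..<2 * n] = map (\<lambda>c. 2 * c) [0..<n]"
proof (induction n)
  case (Suc n)
  have z: "zigzag (Suc n) = zigzag n @ [Up, Down]"
    using zigzag_add[of n 1] by simp
  have "filter (\<lambda>a. zigzag (Suc n) ! a = Up) [0..<2 * n] = filter (\<lambda>a. zigzag n ! a = Up) [0..<2 * n]"
    unfolding z by (rule filter_cong) (simp_all add: nth_append)
  moreover have "[0..<2 * Suc n] = [0..<2 * n] @ [2 * n, Suc (2 * n)]"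
    by simp
  ultimately show ?case
    using Suc.IH by (simp add: z nth_append del: zigzag_Suc)
qed simp

lemma left_end_zigzag:
  assumes "\<sigma> permutes {1..n}" "i \<in> {1..n}"
  shows "left_end (zigzag n) \<sigma> i = 2 * (inv \<sigma> i - 1)"
proof -
  have "inv \<sigma> i \<in> {1..n}"
    using permutes_in_image[OF permutes_inv[OF assms(1)]] assms(2) by blast
  then show ?thesis
    unfolding left_end_def length_zigzag filter_Up_zigzag by auto
qed

lemma right_end_zigzag:
  assumes "\<sigma> permutes {1..n}" "i \<in> {1..n}"
  shows "right_end (zigzag n) \<sigma> i = 2 * (inv \<sigma> i - 1) + 1"
proof -
  have "inv \<sigma> i \<in> {1..n}"
    using permutes_in_image[OF permutes_inv[OF assms(1)]] assms(2) by blast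
  then show ?thesis
    unfolding right_end_def left_end_zigzag[OF assms] matching_down_def
    by (intro Least_equality) (auto simp: height_take_zigzag)
qed

text \<open>The chords are disjoint unit segments, so a chord starts left of another one exactly
  when it also ends left of it; both counts agree.\<close>

lemma insertion_sequence_zigzag:
  assumes "\<sigma> permutes {1..n}" "i \<in> {1..n}"
  shows "insertion_sequence (zigzag n) \<sigma> i = 2 * insertion_code \<sigma> i"
proof -
  have inv: "1 \<le> inv \<sigma> j" if "j \<in> {1..n}" for j
    using permutes_in_image[OF permutes_inv[OF assms(1)], of j] that by auto
  have "left_end (zigzag n) \<sigma> j < left_end (zigzag n) \<sigma> i \<longleftrightarrow> inv \<sigma> j < inv \<sigma> i"
    "right_end (zigzag n) \<sigma> j < left_end (zigzag n) \<sigma> i \<longleftrightarrow> inv \<sigma> j < inv \<sigma> i"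
    if "j \<in> {1..<i}" for j
  proof -
    have j: "j \<in> {1..n}"
      using that assms(2) by auto
    show "left_end (zigzag n) \<sigma> j < left_end (zigzag n) \<sigma> i \<longleftrightarrow> inv \<sigma> j < inv \<sigma> i"
      "right_end (zigzag n) \<sigma> j < left_end (zigzag n) \<sigma> i \<longleftrightarrow> inv \<sigma> j < inv \<sigma> i"
      unfolding left_end_zigzag[OF assms(1) j] left_end_zigzag[OF assms] right_end_zigzag[OF assms(1) j]
      using inv[OF j] inv[OF assms(2)] by linarith+
  qed
  then have "{j \<in> {1..<i}. left_end (zigzag n) \<sigma> j < left_end (zigzag n) \<sigma> i} = {j \<in> {1..<i}. inv \<sigma> j < inv \<sigma> i}"
    "{j \<in> {1..<i}. right_end (zigzag n) \<sigma> j < left_end (zigzag n) \<sigma> i} = {j \<in> {1..<i}. inv \<sigma> j < inv \<sigma> i}"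
    by blast+
  then show ?thesis
    unfolding insertion_sequence_def insertion_code_def by simp
qed

section \<open>Iterated growth as a bijection\<close>

context dyck_bijection
begin

context
  fixes g :: "dyck_tiling \<Rightarrow> int \<Rightarrow> dyck_tiling"
  assumes step: "\<And>u v k. dyck_word u \<Longrightarrow> dyck_word v \<Longrightarrow> length (u @ v) = 2 * k \<Longrightarrow>
    g (one_box_tiling (zigzag k) (u @ v)) (int (length u) - int k) =
      one_box_tiling (zigzag (Suc k)) (u @ Up # f v @ [Down])"
begin

text \<open>The site \<open>p k - (k - 1)\<close> is the column of index \<open>2 * c k\<close> in
  the path of order \<open>k - 1\<close>, which is where \<open>grow_word\<close> cuts; hence
  \<open>step\<close> applies each time.\<close>

lemma grow_eq_one_box_tiling:
  assumes "laminar_code n c" "\<And>k. k \<in> {1..n} \<Longrightarrow> p k = 2 * c k"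
  shows "grow g p n = one_box_tiling (zigzag n) (grow_word f c n)"
  using assms
proof (induction n)
  case 0
  show ?case
    by (simp add: empty_tiling_def one_box_tiling_def path_points_def boxes_between_def)
next
  case (Suc n)
  have c: "laminar_code n c"
    using Suc.prems(1) laminar_code_Suc by blast
  note s = grow_word_split[OF Suc.prems(1)]
  have "grow g p n = one_box_tiling (zigzag n) (grow_word f c n)"
    using Suc.IH[OF c] Suc.prems(2) by simp
  moreover have "p (Suc n) = 2 * c (Suc n)"
    using Suc.prems(2) by simp
  ultimately show ?case
    using step[OF s(1,2), of n] grow_word(2)[OF c] s(3)
    by (simp del: zigzag_Suc)
qed

text \<open>The map is a composite of three bijections: from permutations to laminar codes, from
  these to Dyck words, and from these to one-box tilings.\<close>

lemma bij_betw_grow: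
  "bij_betw (\<lambda>\<sigma>. grow g (insertion_sequence (zigzag n) \<sigma>) n)
     {\<sigma>. \<sigma> permutes {1..n} \<and> avoids_231 n \<sigma>}
     (one_box_tiling (zigzag n) ` {w. dyck_word w \<and> length w = 2 * n})"
proof -
  have eq: "grow g (insertion_sequence (zigzag n) \<sigma>) n =
      one_box_tiling (zigzag n) (grow_word f (insertion_code \<sigma>) n)"
    if "\<sigma> permutes {1..n}" "avoids_231 n \<sigma>" for \<sigma>
    using grow_eq_one_box_tiling[OF laminar_insertion_code[OF that]] insertion_sequence_zigzag[OF that(1)]
    by blast
  show ?thesis
  proof (rule bij_betw_imageI)
    show "inj_on (\<lambda>\<sigma>. grow g (insertion_sequence (zigzag n) \<sigma>) n) {\<sigma>. \<sigma> permutes {1..n} \<and> avoids_231 n \<sigma>}"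
    proof (rule inj_onI; clarify)
      fix \<sigma> \<sigma>'
      assume \<sigma>: "\<sigma> permutes {1..n}" "avoids_231 n \<sigma>" and \<sigma>': "\<sigma>' permutes {1..n}" "avoids_231 n \<sigma>'"
        and "grow g (insertion_sequence (zigzag n) \<sigma>) n = grow g (insertion_sequence (zigzag n) \<sigma>') n"
      note lam = laminar_insertion_code[OF \<sigma>] laminar_insertion_code[OF \<sigma>']
      then have "grow_word f (insertion_code \<sigma>) n = grow_word f (insertion_code \<sigma>') n"
        using \<open>grow g _ n = _\<close> one_box_tiling_inj grow_word(1) unfolding eq[OF \<sigma>] eq[OF \<sigma>'] by blast
      then show "\<sigma> = \<sigma>'"
        using insertion_code_inj[OF \<sigma> \<sigma>'] grow_word_inj[OF lam] by blast
    qed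
    show "(\<lambda>\<sigma>. grow g (insertion_sequence (zigzag n) \<sigma>) n) ` {\<sigma>. \<sigma> permutes {1..n} \<and> avoids_231 n \<sigma>} =
        one_box_tiling (zigzag n) ` {w. dyck_word w \<and> length w = 2 * n}"
    proof (intro equalityI subsetI)
      fix T assume "T \<in> one_box_tiling (zigzag n) ` {w. dyck_word w \<and> length w = 2 * n}"
      then obtain w where w: "dyck_word w" "length w = 2 * n" "T = one_box_tiling (zigzag n) w"
        by blast
      obtain c where c: "laminar_code n c" "grow_word f c n = w"
        using grow_word_surj[OF w(1,2)] by blast
      obtain \<sigma> where \<sigma>: "\<sigma> permutes {1..n}" "avoids_231 n \<sigma>"
        "\<And>k. k \<in> {1..n} \<Longrightarrow> insertion_code \<sigma> k = c k"
        using insertion_code_surj[OF c(1)] by blast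
      have "T = grow g (insertion_sequence (zigzag n) \<sigma>) n"
        using eq[OF \<sigma>(1,2)] grow_word_cong[of n "insertion_code \<sigma>" c f] \<sigma>(3) w(3) c(2) by simp
      then show "T \<in> (\<lambda>\<sigma>. grow g (insertion_sequence (zigzag n) \<sigma>) n) ` {\<sigma>. \<sigma> permutes {1..n} \<and> avoids_231 n \<sigma>}"
        using \<sigma> by blast
    qed (use eq laminar_insertion_code grow_word(1,2) in auto)
  qed
qed

end

end

theorem theorem9:
  fixes n :: nat
  shows
    "bij_betw (DTS (zigzag n))
       {\<sigma>. \<sigma> permutes {1..n} \<and> avoids_231 n \<sigma>}
       {T. is_dyck_tiling T \<and> cover_inclusive T \<and> lower T = path_points (zigzag n) \<and>
           (\<forall>t\<in>tiles T. card t = 1)} \<and>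
     bij_betw (DTR (zigzag n))
       {\<sigma>. \<sigma> permutes {1..n} \<and> avoids_231 n \<sigma>}
       {T. is_dyck_tiling T \<and> cover_inclusive T \<and> lower T = path_points (zigzag n) \<and>
           (\<forall>t\<in>tiles T. card t = 1)}"
proof -
  \<comment> \<open>A strip keeps the word right of the site intact, hence the identity; a ribbon
    rotates it.\<close>
  interpret strip: dyck_bijection "\<lambda>w. w"
    by unfold_locales auto
  interpret ribbon: dyck_bijection rotate_last
    by unfold_locales (simp_all add: dyck_word_rotate_last inj_on_rotate_last)
  have "DTS (zigzag n) = (\<lambda>\<sigma>. grow strip_grow (insertion_sequence (zigzag n) \<sigma>) n)"
    "DTR (zigzag n) = (\<lambda>\<sigma>. grow ribbon_grow (insertion_sequence (zigzag n) \<sigma>) n)"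
    by (simp_all add: fun_eq_iff DTS_def DTR_def)
  then show ?thesis
    using strip.bij_betw_grow[OF strip_grow_zigzag] ribbon.bij_betw_grow[OF ribbon_grow_zigzag]
    by (simp only: zigzag_one_box_tilings)
qed

end
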